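(* Let $k\ge1$ and $n\ge 2k$ be integers. For $\lambda\in\{\rho,q\}$, let $\operatorname{spex}_{\lambda}^{\mathrm B}(2n,C_{2n};\delta\ge k)$ be the maximum of $\lambda(G)$ over all non-Hamiltonian balanced bipartite graphs $G$ of order $2n$ with minimum degree $\delta(G)\ge k$, and let $\operatorname{SPEX}_{\lambda}^{\mathrm B}(2n,C_{2n};\delta\ge k)$ be the family of graphs (up to isomorphism) attaining this maximum. Then \[ \operatorname{SPEX}_{\rho}^{\mathrm B}(2n,C_{2n};\delta\ge k)=\{B_n^k\}\quad\text{and}\quad \operatorname{spex}_{\rho}^{\mathrm B}(2n,C_{2n};\delta\ge k)=\rho(B_n^k), \] and \[ \operatorname{SPEX}_{q}^{\mathrm B}(2n,C_{2n};\delta\ge k)=\{B_n^k\}\quad\text{and}\quad \operatorname{spex}_{q}^{\mathrm B}(2n,C_{2n};\delta\ge k)=q(B_n^k). \]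
   Context: All graphs are finite and simple. A balanced bipartite graph of order $2n$ is a bipartite graph $G=G[X,Y]$ with partite sets $X,Y$, $|X|=|Y|=n$. A graph is Hamiltonian if it contains a Hamilton cycle. For a graph $G$ with adjacency matrix $A(G)$ and diagonal degree matrix $D(G)$, $\rho(G)$ is the largest eigenvalue of $A(G)$ (spectral radius), and $q(G)$ is the largest eigenvalue of $D(G)+A(G)$ (signless Laplacian spectral radius). For $1\le s\le\lfloor n/2\rfloor$, $B_n^s$ is the balanced bipartite graph with bipartition $X=X_1\cup X_2$, $Y=Y_1\cup Y_2$ (disjoint unions), $|X_1|=|Y_1|=s$, $|X_2|=|Y_2|=n-s$, and edge set $\{xy:x\in X_1,\ y\in Y_1\}\cup\{xy:x\in X_2,\ y\in Y\}$. *)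

theory Defs
  imports "Jordan_Normal_Form.Spectral_Radius"
begin

datatype 'a graph = Graph (verts: "'a set") (edges: "'a set set")

definition fin_simple_graph :: "'a graph \<Rightarrow> bool" where
  "fin_simple_graph G \<longleftrightarrow> finite (verts G) \<and> (\<forall>e\<in>edges G. e \<subseteq> verts G \<and> card e = 2)"

definition graph_iso :: "'a graph \<Rightarrow> 'b graph \<Rightarrow> bool" where
  "graph_iso G H \<longleftrightarrow>
     (\<exists>f. bij_betw f (verts G) (verts H) \<and>
          (\<forall>u\<in>verts G. \<forall>v\<in>verts G. {u, v} \<in> edges G \<longleftrightarrow> {f u, f v} \<in> edges H))"

definition iso_class :: "'a graph \<Rightarrow> 'a graph set" where
  "iso_class G = {H. fin_simple_graph H \<and> graph_iso G H}"

definition vdegree :: "'a graph \<Rightarrow> 'a \<Rightarrow> nat" where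
  "vdegree G v = card {w \<in> verts G. {v, w} \<in> edges G}"

definition min_degree :: "'a graph \<Rightarrow> nat" where
  "min_degree G = Min (vdegree G ` verts G)"

definition balanced_bipartite :: "nat \<Rightarrow> 'a graph \<Rightarrow> bool" where
  "balanced_bipartite n G \<longleftrightarrow> fin_simple_graph G \<and>
     (\<exists>X Y. verts G = X \<union> Y \<and> X \<inter> Y = {} \<and> card X = n \<and> card Y = n \<and>
            (\<forall>e\<in>edges G. \<exists>x\<in>X. \<exists>y\<in>Y. e = {x, y}))"

definition hamilton_cycle :: "'a graph \<Rightarrow> 'a list \<Rightarrow> bool" where
  "hamilton_cycle G c \<longleftrightarrow> length c \<ge> 3 \<and> distinct c \<and> set c = verts G \<and>
     (\<forall>i<length c. {c ! i, c ! (Suc i mod length c)} \<in> edges G)"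

definition hamiltonian :: "'a graph \<Rightarrow> bool" where
  "hamiltonian G \<longleftrightarrow> (\<exists>c. hamilton_cycle G c)"

text \<open>Matrices are indexed by positions, so the vertices are listed in increasing order; the
  spectra below do not depend on this choice.\<close>

definition vert_list :: "'a :: linorder graph \<Rightarrow> 'a list" where
  "vert_list G = sorted_list_of_set (verts G)"

definition adjacency_mat :: "'a :: linorder graph \<Rightarrow> real mat" where
  "adjacency_mat G = mat (card (verts G)) (card (verts G))
     (\<lambda>(i, j). if {vert_list G ! i, vert_list G ! j} \<in> edges G then 1 else 0)"

definition degree_mat :: "'a :: linorder graph \<Rightarrow> real mat" where
  "degree_mat G = mat (card (verts G)) (card (verts G))
     (\<lambda>(i, j). if i = j then real (vdegree G (vert_list G ! i)) else 0)"

text \<open>Both matrices are real symmetric, so the real spectrum is the whole spectrum.\<close>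

definition graph_rho :: "'a :: linorder graph \<Rightarrow> real" where
  "graph_rho G = Max (spectrum (adjacency_mat G))"

definition graph_q :: "'a :: linorder graph \<Rightarrow> real" where
  "graph_q G = Max (spectrum (degree_mat G + adjacency_mat G))"

text \<open>Vertices are taken in \<^typ>\<open>nat\<close>: every finite graph is isomorphic to one of this form.\<close>

definition nonham_class :: "nat \<Rightarrow> nat \<Rightarrow> nat graph set" where
  "nonham_class n k = {G. balanced_bipartite n G \<and> \<not> hamiltonian G \<and> min_degree G \<ge> k}"

definition spex :: "(nat graph \<Rightarrow> real) \<Rightarrow> nat \<Rightarrow> nat \<Rightarrow> real" where
  "spex lam n k = (GREATEST r. r \<in> lam ` nonham_class n k)"

text \<open>``Up to isomorphism'' is rendered by collecting isomorphism classes. Attainment of the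
  maximum is spelled out so that it does not rely on \<^term>\<open>spex lam n k\<close> being well defined.\<close>

definition SPEX :: "(nat graph \<Rightarrow> real) \<Rightarrow> nat \<Rightarrow> nat \<Rightarrow> nat graph set set" where
  "SPEX lam n k =
     iso_class ` {G \<in> nonham_class n k. \<forall>H\<in>nonham_class n k. lam H \<le> lam G}"

text \<open>Here \<open>X\<^sub>1 = {0..<s}\<close>, \<open>X\<^sub>2 = {s..<n}\<close>, \<open>Y\<^sub>1 = {n..<n+s}\<close> and
  \<open>Y\<^sub>2 = {n+s..<2*n}\<close>; meaningful for \<open>s \<le> n\<close>.\<close>

definition B_graph :: "nat \<Rightarrow> nat \<Rightarrow> nat graph" where
  "B_graph n s = Graph {0..<2*n}
     ({{x, y} | x y. x \<in> {0..<s} \<and> y \<in> {n..<n+s}} \<union>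
      {{x, y} | x y. x \<in> {s..<n} \<and> y \<in> {n..<2*n}})"

end

theory Submission
  imports Defs
begin

text \<open>The theorem follows from a sufficient condition for Hamilton cycles and a comparison of eigenvalues.

By the argument of Moon and Moser, a non-Hamiltonian balanced bipartite graph of order \<open>2 * n\<close> has
in one of its sides a set \<open>S\<close> of \<open>s \<le> n / 2\<close> vertices of degree at most \<open>s\<close>
(\<open>nonhamiltonian_low_degree_set\<close>).  To see this, add edges until every further edge would create a
Hamilton cycle, and take a non-adjacent pair \<open>x\<close>, \<open>y\<close> of largest degree sum.  Adding \<open>{x, y}\<close>
closes a Hamilton path from \<open>x\<close> to \<open>y\<close>; the predecessors on it of the neighbours of \<open>x\<close> are not
adjacent to \<open>y\<close>, hence have degree at most that of \<open>x\<close>, and their number is the degree of \<open>x\<close>.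
The same holds from the other end, and the two degrees add up to at most \<open>n\<close>.  Minimum degree at
least \<open>k\<close> forces \<open>k \<le> s\<close>.

Such a set \<open>S\<close> alone bounds every eigenvalue \<open>\<mu>\<close> of \<open>e * D + A\<close>, where \<open>D\<close> is the degree
matrix, \<open>A\<close> the adjacency matrix and \<open>e \<ge> 0\<close>; the two cases of the theorem are \<open>e = 0\<close> and
\<open>e = 1\<close>.  Let \<open>g\<close> be the absolute value of an eigenvector, and let \<open>P\<close>, \<open>Q\<close>, \<open>R\<close>, \<open>U\<close> be the sums
of \<open>g\<close> over \<open>S\<close>, over the rest \<open>X - S\<close> of its side, over a heaviest \<open>s\<close>-subset \<open>T\<close> of the other side
\<open>Y\<close>, and over all of \<open>Y\<close>.  The eigenvalue equations give four linear inequalities for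
\<open>(P, Q, R, U)\<close>, all of them equations for the Perron vector of \<open>B_graph n s\<close>.  Weighting them with that
Perron vector yields \<open>\<mu> \<le> \<theta>\<close> for its largest eigenvalue \<open>\<theta>\<close>
(\<open>block_perron_comparison\<close>).  If \<open>\<mu> = \<theta>\<close> all the inequalities are tight, and tightness
forces \<open>S\<close> to be joined exactly to \<open>T\<close> and the rest of \<open>X\<close> to all of \<open>Y\<close>, which is
\<open>B_graph n s\<close> (\<open>eigenvalue_bound_of_low_degree_set\<close>).

Finally \<open>\<theta>\<close> has a closed form in \<open>n\<close> and \<open>p = s * (n - s)\<close> which decreases strictly in \<open>p\<close>,
and \<open>p\<close> increases strictly with \<open>s \<le> n / 2\<close>.  So \<open>s = k\<close> is the only case in which the maximum
is reached.\<close>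

section \<open>The Perron vector of the block structure\<close>

text \<open>In \<open>B_graph (s + r) s\<close>, vertices of the same block \<open>X\<^sub>1\<close>, \<open>X\<^sub>2\<close>, \<open>Y\<^sub>1\<close>, \<open>Y\<^sub>2\<close> have the same number of
neighbours in each block.  The equations say that the vector with the values \<open>a\<close>, \<open>b\<close>, \<open>c\<close>, \<open>d\<close> on
these blocks is an eigenvector of \<open>e * D + A\<close> with eigenvalue \<open>\<theta>\<close>.  The condition \<open>d < c\<close>
reflects that the vertices of \<open>Y\<^sub>2\<close> lack the neighbours \<open>X\<^sub>1\<close> of those of \<open>Y\<^sub>1\<close>; it makes the weight of \<open>R\<close> in the comparison below positive.\<close>

definition block_perron ::
  "real \<Rightarrow> nat \<Rightarrow> nat \<Rightarrow> real \<Rightarrow> real \<Rightarrow> real \<Rightarrow> real \<Rightarrow> real \<Rightarrow> bool" where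
  "block_perron e s r \<theta> a b c d \<longleftrightarrow>
     0 < a \<and> 0 < b \<and> 0 < d \<and> d < c \<and>
     \<theta> * a = s * (e * a + c) \<and>
     \<theta> * b = e * real (s + r) * b + s * c + r * d \<and>
     \<theta> * c = e * real (s + r) * c + s * a + r * b \<and>
     \<theta> * d = e * r * d + r * b"

text \<open>Since \<open>c * R + d * (U - R) = (c - d) * R + d * U\<close>, pairing the Perron vector with block sums
\<open>P\<close>, \<open>Q\<close>, \<open>R\<close>, \<open>U - R\<close> gives the combination \<open>W\<close> in the proof.  It has positive coefficients, and the same
combination of the right-hand sides is \<open>\<theta> * W\<close>.  The total \<open>U\<close> is used in place of the sum
\<open>U - R\<close> over the last block because an arbitrary graph satisfies no such upper bound for \<open>U - R\<close>.\<close>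

lemma block_perron_comparison:
  fixes \<mu> :: real
  assumes pw: "block_perron e s r \<theta> a b c d"
    and pos: "0 < s" "0 < r"
    and nonneg: "0 \<le> e" "0 \<le> P" "0 \<le> Q" "0 \<le> R" "R \<le> U"
    and nz: "0 < P + Q + U"
    and i1: "\<mu> * P \<le> s * (e * P + R)"
    and i2: "\<mu> * Q \<le> e * real (s + r) * Q + r * U"
    and i3: "\<mu> * R \<le> e * real (s + r) * R + s * (P + Q)"
    and i4: "\<mu> * U \<le> e * (s * R + r * U) + s * P + real (s + r) * Q"
  shows "\<mu> \<le> \<theta>"
    and "\<mu> = \<theta> \<Longrightarrow> 0 < R \<and> 0 < U \<and> \<mu> * P = s * (e * P + R) \<and> \<mu> * Q = e * real (s + r) * Q + r * U \<and>
           \<mu> * R = e * real (s + r) * R + s * (P + Q) \<and> \<mu> * U = e * (s * R + r * U) + s * P + real (s + r) * Q"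
proof -
  have w: "0 < a" "0 < b" "0 < c - d" "0 < d"
    and ea: "\<theta> * a = s * (e * a + c)"
    and eb: "\<theta> * b = e * real (s + r) * b + s * c + r * d"
    and ec: "\<theta> * c = e * real (s + r) * c + s * a + r * b"
    and ed: "\<theta> * d = e * r * d + r * b"
    using pw by (auto simp: block_perron_def)
  define W where "W = a * P + b * Q + (c - d) * R + d * U"
  let ?r1 = "s * (e * P + R)" and ?r2 = "e * real (s + r) * Q + r * U"
  let ?r3 = "e * real (s + r) * R + s * (P + Q)" and ?r4 = "e * (s * R + r * U) + s * P + real (s + r) * Q"
  have "a * ?r1 + b * ?r2 + (c - d) * ?r3 + d * ?r4 =
      (s * (e * a + c)) * P + (e * real (s + r) * b + s * c + r * d) * Q
      + ((e * real (s + r) * c + s * a + r * b) - (e * r * d + r * b)) * R + (e * r * d + r * b) * U"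
    by (simp add: algebra_simps)
  also have "\<dots> = \<theta> * W"
    unfolding ea[symmetric] eb[symmetric] ec[symmetric] ed[symmetric] W_def
    by (simp add: algebra_simps)
  finally have tot: "a * ?r1 + b * ?r2 + (c - d) * ?r3 + d * ?r4 = \<theta> * W" .
  have g: "0 \<le> a * (?r1 - \<mu> * P)" "0 \<le> b * (?r2 - \<mu> * Q)" "0 \<le> (c - d) * (?r3 - \<mu> * R)"
      "0 \<le> d * (?r4 - \<mu> * U)"
    using w i1 i2 i3 i4 by simp_all
  have gap: "a * (?r1 - \<mu> * P) + b * (?r2 - \<mu> * Q) + (c - d) * (?r3 - \<mu> * R) + d * (?r4 - \<mu> * U)
      = (\<theta> - \<mu>) * W"
    using tot unfolding W_def by (simp add: algebra_simps)
  have U: "0 \<le> U" using nonneg by linarith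
  have Wterms: "0 \<le> a * P" "0 \<le> b * Q" "0 \<le> (c - d) * R" "0 \<le> d * U"
    using w nonneg U by simp_all
  have W: "0 < W"
  proof -
    have "0 < P \<or> 0 < Q \<or> 0 < U" using nz nonneg U by linarith
    then have "0 < a * P \<or> 0 < b * Q \<or> 0 < d * U" using w by auto
    then show ?thesis unfolding W_def using Wterms by linarith
  qed
  have "0 \<le> (\<theta> - \<mu>) * W" using g gap by linarith
  then show "\<mu> \<le> \<theta>" using W by (simp add: zero_le_mult_iff)
  assume eq: "\<mu> = \<theta>"
  then have "(\<theta> - \<mu>) * W = 0" by simp
  then have "a * (?r1 - \<mu> * P) = 0" "b * (?r2 - \<mu> * Q) = 0" "(c - d) * (?r3 - \<mu> * R) = 0"
      "d * (?r4 - \<mu> * U) = 0"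
    using g gap by linarith+
  then have q: "\<mu> * P = ?r1" "\<mu> * Q = ?r2" "\<mu> * R = ?r3" "\<mu> * U = ?r4"
    using w by simp_all
  \<comment> \<open>If \<open>R\<close> vanished, the tight third and second relations would make all block sums vanish.\<close>
  have "R \<noteq> 0"
  proof
    assume R0: "R = 0"
    then have "real s * (P + Q) = 0" using q(3) by simp
    then have "P = 0" "Q = 0" using pos nonneg by auto
    then have "real r * U = 0" using q(2) by simp
    then have "U = 0" using pos by auto
    with \<open>P = 0\<close> \<open>Q = 0\<close> nz show False by simp
  qed
  then show "0 < R \<and> 0 < U \<and> \<mu> * P = ?r1 \<and> \<mu> * Q = ?r2 \<and> \<mu> * R = ?r3 \<and> \<mu> * U = ?r4"
    using q nonneg by auto
qed

text \<open>For \<open>e = 0\<close> the characteristic equation of the quotient is \<open>t\<^sup>2 - (n\<^sup>2 - p) * t + p\<^sup>2 = 0\<close> in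
\<open>t = \<theta>\<^sup>2\<close>, with \<open>p = s * r\<close>.\<close>

definition adjacency_root :: "real \<Rightarrow> real \<Rightarrow> real" where
  "adjacency_root n p = sqrt ((n\<^sup>2 - p + sqrt ((n\<^sup>2 - 3 * p) * (n\<^sup>2 + p))) / 2)"

text \<open>For \<open>e = 1\<close> the characteristic polynomial of the quotient is, up to sign,
\<open>q * (q - n) * (q\<^sup>2 - 2 * n * q + 2 * p)\<close>.\<close>

definition signless_root :: "real \<Rightarrow> real \<Rightarrow> real" where
  "signless_root n p = n + sqrt (n\<^sup>2 - 2 * p)"

lemma adjacency_root_strict_antimono:
  assumes "0 \<le> p" "p < p'" "4 * p' \<le> n\<^sup>2"
  shows "adjacency_root n p' < adjacency_root n p"
proof -
  have "(n\<^sup>2 - 3 * p) * (n\<^sup>2 + p) - (n\<^sup>2 - 3 * p') * (n\<^sup>2 + p')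
      = (p' - p) * (2 * n\<^sup>2 + 3 * (p' + p))"
    by (simp add: algebra_simps)
  also have "0 \<le> \<dots>" using assms by simp
  finally have "sqrt ((n\<^sup>2 - 3 * p') * (n\<^sup>2 + p')) \<le> sqrt ((n\<^sup>2 - 3 * p) * (n\<^sup>2 + p))"
    by simp
  then have "n\<^sup>2 - p' + sqrt ((n\<^sup>2 - 3 * p') * (n\<^sup>2 + p')) < n\<^sup>2 - p + sqrt ((n\<^sup>2 - 3 * p) * (n\<^sup>2 + p))"
    using assms(2) by (intro add_less_le_mono) simp_all
  then show ?thesis unfolding adjacency_root_def real_sqrt_less_iff by (rule divide_strict_right_mono) simp
qed

lemma signless_root_strict_antimono:
  "p < p' \<Longrightarrow> signless_root n p' < signless_root n p"
  by (simp add: signless_root_def)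

text \<open>The witness arises by expressing \<open>a\<close> and \<open>d\<close> through \<open>c\<close> and \<open>b\<close>; the equation for \<open>c\<close> then fixes
the ratio \<open>b : c\<close>, and the equation for \<open>b\<close> becomes the characteristic equation.\<close>

lemma adjacency_perron_exists:
  fixes s r :: nat
  assumes pos: "0 < s" "0 < r"
  defines "n \<equiv> real (s + r)" and "p \<equiv> real (s * r)"
  defines "\<theta> \<equiv> adjacency_root n p"
  shows "\<exists>a b c d. block_perron 0 s r \<theta> a b c d"
proof -
  define t where "t = (n\<^sup>2 - p + sqrt ((n\<^sup>2 - 3 * p) * (n\<^sup>2 + p))) / 2"
  have sr: "0 < real s" "0 < real r" using pos by auto
  have p0: "0 < p" using sr by (simp add: p_def)
  have n: "n = real s + real r" "p = real s * real r" by (simp_all add: n_def p_def)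
  have p4: "n\<^sup>2 - 4 * p = (real s - real r)\<^sup>2" unfolding n by (simp add: power2_eq_square algebra_simps)
  then have n4: "4 * p \<le> n\<^sup>2" by (smt (verit) zero_le_power2)
  have disc: "0 \<le> (n\<^sup>2 - 3 * p) * (n\<^sup>2 + p)" using n4 p0 by simp
  have "2 * t - (n\<^sup>2 - p) = sqrt ((n\<^sup>2 - 3 * p) * (n\<^sup>2 + p))" unfolding t_def by (simp only: field_sum_of_halves mult_2 add_diff_cancel_left')
  then have "(2 * t - (n\<^sup>2 - p))\<^sup>2 = (n\<^sup>2 - 3 * p) * (n\<^sup>2 + p)"
    using disc by simp
  then have "4 * (t\<^sup>2 - (n\<^sup>2 - p) * t + p\<^sup>2) = 0"
    by (simp add: power2_eq_square algebra_simps)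
  then have char: "t\<^sup>2 - (n\<^sup>2 - p) * t + p\<^sup>2 = 0" by simp
  have "(n\<^sup>2 - p) / 2 \<le> t" using disc by (simp add: t_def)
  moreover have "0 < (n\<^sup>2 - p) / 2" using n4 p0 by simp
  ultimately have t0: "0 < t" by (rule less_le_trans[rotated])
  \<comment> \<open>The two factors are \<open>t\<close> minus the diagonal entries of the squared adjacency matrix, taken on
    block sums over \<open>X\<^sub>1\<close> and \<open>X\<^sub>2\<close>; at the larger root \<open>t\<close> both are positive, so \<open>b > 0\<close> below.\<close>
  have fact: "(t - real s ^ 2) * (t - real r * n) = real r * real s ^ 3"
    using char unfolding n by (simp add: power2_eq_square power3_eq_cube algebra_simps)
  have "real r * real s ^ 3 > 0" using sr by simp
  then have "0 < (t - real s ^ 2) * (t - real r * n)" using fact by simp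
  moreover have "0 < (t - real s ^ 2) + (t - real r * n)"
  proof -
    have "n\<^sup>2 - p = real s ^ 2 + real r * n" unfolding n by (simp add: power2_eq_square algebra_simps)
    moreover have "0 < sqrt ((n\<^sup>2 - 3 * p) * (n\<^sup>2 + p))" using n4 p0 by simp
    ultimately show ?thesis by (simp add: t_def)
  qed
  ultimately have ts: "real s ^ 2 < t" by (smt (verit) zero_less_mult_iff)
  have th: "\<theta> = sqrt t" by (simp add: \<theta>_def adjacency_root_def t_def)
  then have th0: "0 < \<theta>" and th2: "\<theta> * \<theta> = t" using t0 by simp_all
  let ?a = "real s * real r" and ?b = "t - real s ^ 2" and ?c = "real r * \<theta>"
  let ?d = "real r * (t - real s ^ 2) / \<theta>"
  have dc: "?d < ?c"
    using sr th0 by (simp add: pos_divide_less_eq mult.assoc th2)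
  have e2: "\<theta> * ?b = real s * ?c + real r * ?d"
  proof -
    have "t * ?b = real s * real r * t + real r ^ 2 * ?b"
      using char unfolding n by (simp add: power2_eq_square algebra_simps)
    moreover have "\<theta> * (\<theta> * ?b) = t * ?b" by (simp flip: th2)
    moreover have "\<theta> * (real s * ?c + real r * ?d) = real s * real r * t + real r ^ 2 * ?b"
      using th0 by (simp add: distrib_left power2_eq_square mult_ac flip: th2)
    ultimately have "\<theta> * (\<theta> * ?b) = \<theta> * (real s * ?c + real r * ?d)"
      by simp
    then show ?thesis using th0 by simp
  qed
  have e3: "\<theta> * ?c = real s * ?a + real r * ?b"
    by (simp add: power2_eq_square algebra_simps flip: th2)
  have "block_perron 0 s r \<theta> ?a ?b ?c ?d"
    unfolding block_perron_def using sr ts th0 dc e2 e3 by simp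
  then show ?thesis by blast
qed

text \<open>For \<open>e = 1\<close> the Perron vector takes the same value on \<open>X\<^sub>2\<close> and \<open>Y\<^sub>1\<close>, normalised here to
\<open>b = c = 1\<close>; the other two values are then determined by their own equations.\<close>

lemma signless_perron_exists:
  fixes s r :: nat
  assumes pos: "0 < s" "0 < r"
  defines "n \<equiv> real (s + r)" and "p \<equiv> real (s * r)"
  defines "\<theta> \<equiv> signless_root n p"
  shows "\<exists>a b c d. block_perron 1 s r \<theta> a b c d"
proof -
  have sr: "0 < real s" "0 < real r" using pos by auto
  have n: "n = real s + real r" "p = real s * real r" by (simp_all add: n_def p_def)
  have disc: "n\<^sup>2 - 2 * p = (real s)\<^sup>2 + (real r)\<^sup>2" unfolding n by (simp add: power2_eq_square algebra_simps)
  have disc0: "0 < n\<^sup>2 - 2 * p" unfolding disc using sr by (simp add: add_pos_pos)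
  then have thn: "n < \<theta>" by (simp add: \<theta>_def signless_root_def)
  have "(\<theta> - n)\<^sup>2 = n\<^sup>2 - 2 * p" using disc0 by (simp add: \<theta>_def signless_root_def)
  then have char: "\<theta> * \<theta> = 2 * n * \<theta> - 2 * p" by (simp add: power2_eq_square algebra_simps)
  have gt: "0 < \<theta> - real s" "0 < \<theta> - real r" using thn sr n by linarith+
  let ?a = "real s / (\<theta> - real s)" and ?d = "real r / (\<theta> - real r)"
  have a: "\<theta> * ?a = real s * (?a + 1)" using gt by (simp add: field_simps)
  have d: "\<theta> * ?d = real r * ?d + real r" using gt by (simp add: field_simps)
  have b: "\<theta> = n + real s + real r * ?d"
  proof -
    have "(\<theta> - n - real s) * (\<theta> - real r) = real r * real r"
      using char unfolding n by (simp add: algebra_simps)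
    then show ?thesis using gt by (simp add: field_simps)
  qed
  have c: "\<theta> = n + real s * ?a + real r"
  proof -
    have "(\<theta> - n - real r) * (\<theta> - real s) = real s * real s"
      using char unfolding n by (simp add: algebra_simps)
    then show ?thesis using gt by (simp add: field_simps)
  qed
  have "0 < real s * ?a" using sr gt by simp
  then have "n + real r < \<theta>" using c by (metis add_less_cancel_right less_add_same_cancel1)
  then have d1: "?d < 1" using gt n sr by (simp add: pos_divide_less_eq)
  have "block_perron 1 s r \<theta> ?a 1 1 ?d"
    unfolding block_perron_def using sr gt thn d1 a b c d n by simp
  then show ?thesis by blast
qed

section \<open>Bipartitions and neighbourhoods\<close>

definition nbrs :: "'a graph \<Rightarrow> 'a \<Rightarrow> 'a set" where
  "nbrs G v = {w \<in> verts G. {v, w} \<in> edges G}"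

definition bipartition :: "'a graph \<Rightarrow> 'a set \<Rightarrow> 'a set \<Rightarrow> bool" where
  "bipartition G X Y \<longleftrightarrow> fin_simple_graph G \<and> verts G = X \<union> Y \<and> X \<inter> Y = {} \<and>
     (\<forall>e\<in>edges G. \<exists>x\<in>X. \<exists>y\<in>Y. e = {x, y})"

lemma vdegree_eq_card_nbrs: "vdegree G v = card (nbrs G v)"
  by (simp add: vdegree_def nbrs_def)

lemma nbrs_sym: "u \<in> verts G \<Longrightarrow> v \<in> nbrs G u \<Longrightarrow> u \<in> nbrs G v"
  by (simp add: nbrs_def insert_commute)

lemma bipartition_commute: "bipartition G X Y \<Longrightarrow> bipartition G Y X"
  unfolding bipartition_def by (metis Int_commute Un_commute insert_commute)

lemma bipartition_finite: "bipartition G X Y \<Longrightarrow> finite X \<and> finite Y"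
  unfolding bipartition_def fin_simple_graph_def by (metis finite_Un)

lemma bipartition_nbrs:
  assumes "bipartition G X Y" "x \<in> X"
  shows "nbrs G x \<subseteq> Y"
  using assms by (fastforce simp: bipartition_def nbrs_def doubleton_eq_iff)

lemma balanced_bipartite_bipartition:
  "balanced_bipartite n G \<longleftrightarrow> (\<exists>X Y. bipartition G X Y \<and> card X = n \<and> card Y = n)"
  unfolding balanced_bipartite_def bipartition_def by auto

text \<open>Double counting of the edges, each weighted by its end in \<open>Y\<close>.\<close>

lemma degree_sum:
  fixes h :: "'a \<Rightarrow> real"
  assumes bip: "bipartition G X Y"
  shows "(\<Sum>y\<in>Y. h y * vdegree G y) = (\<Sum>x\<in>X. sum h (nbrs G x))"
proof -
  have V: "verts G = X \<union> Y" using bip by (auto simp: bipartition_def)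
  have fin: "finite X" "finite Y" using bipartition_finite[OF bip] by auto
  have nY: "nbrs G y = {x. x \<in> X \<and> {x, y} \<in> edges G}" if "y \<in> Y" for y
    using bipartition_nbrs[OF bipartition_commute[OF bip] that] V by (auto simp: nbrs_def insert_commute)
  have nX: "nbrs G x = {y. y \<in> Y \<and> {x, y} \<in> edges G}" if "x \<in> X" for x
    using bipartition_nbrs[OF bip that] V by (auto simp: nbrs_def)
  have "(\<Sum>y\<in>Y. h y * vdegree G y) = (\<Sum>y\<in>Y. \<Sum>x | x \<in> X \<and> {x, y} \<in> edges G. h y)"
    by (intro sum.cong) (simp_all add: vdegree_eq_card_nbrs nY)
  also have "\<dots> = (\<Sum>x\<in>X. \<Sum>y | y \<in> Y \<and> {x, y} \<in> edges G. h y)"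
    using sum.swap_restrict[OF fin(2) fin(1), of "\<lambda>y x. h y" "\<lambda>y x. {x, y} \<in> edges G"] by simp
  also have "\<dots> = (\<Sum>x\<in>X. sum h (nbrs G x))"
    by (intro sum.cong) (simp_all add: nX)
  finally show ?thesis .
qed


section \<open>Eigenvalues of bipartite graphs with a set of low degree\<close>

text \<open>Each neighbourhood of a vertex in \<open>S\<close> has at most \<open>s\<close> elements.  An \<open>s\<close>-subset \<open>T\<close> of largest weight
dominates all of them at once, and it plays the role of the block \<open>Y\<^sub>1\<close>.\<close>

lemma heaviest_subset_exists:
  fixes g :: "'a \<Rightarrow> real"
  assumes fin: "finite Y" and s: "s \<le> card Y" and g: "\<And>y. y \<in> Y \<Longrightarrow> 0 \<le> g y"
  obtains T where "T \<subseteq> Y" "card T = s" "\<And>A. A \<subseteq> Y \<Longrightarrow> card A \<le> s \<Longrightarrow> sum g A \<le> sum g T"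
proof -
  let ?F = "{T. T \<subseteq> Y \<and> card T = s}"
  have finF: "finite ?F" using fin by simp
  have neF: "?F \<noteq> {}" using obtain_subset_with_card_n[OF s] by blast
  have "Max (sum g ` ?F) \<in> sum g ` ?F" using finF neF by simp
  then obtain T where T: "T \<subseteq> Y" "card T = s" "Max (sum g ` ?F) = sum g T" by auto
  have "sum g A \<le> sum g T" if A: "A \<subseteq> Y" "card A \<le> s" for A
  proof -
    obtain B where B: "A \<subseteq> B" "B \<subseteq> Y" "card B = s"
      using exists_subset_between[OF A(2) s A(1) fin] by blast
    have "sum g A \<le> sum g B"
      using B fin g by (intro sum_mono2) (auto intro: finite_subset)
    also have "\<dots> \<le> sum g T" unfolding T(3)[symmetric] using finF B by (intro Max_ge) auto
    finally show ?thesis .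
  qed
  with T that show thesis by blast
qed

text \<open>Summing the eigenvalue inequalities over \<open>S\<close>, \<open>X - S\<close>, \<open>T\<close> and \<open>Y\<close> gives the four premises of
\<open>block_perron_comparison\<close>.  The degree bound on \<open>S\<close> enters through \<open>sum g (nbrs G x) \<le> sum g T\<close> for
\<open>x \<in> S\<close>, through the diagonal terms, and, in the sum over \<open>Y\<close>, through double counting of the edges.

If \<open>\<mu> = \<theta>\<close>, each termwise estimate is an equality.  The first two then show that \<open>g\<close> is positive on
\<open>X\<close>, so that no neighbour can be missing where a sum over a neighbourhood is largest possible: vertices
of \<open>T\<close> are adjacent to all of \<open>X\<close>, and vertices of \<open>X - S\<close> have full degree.\<close>

lemma eigenvalue_bound_of_low_degree_set:
  fixes g :: "'a \<Rightarrow> real" and \<mu> e \<theta> :: real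
  assumes bip: "bipartition G X Y" and cX: "card X = s + r" and cY: "card Y = s + r"
    and S: "S \<subseteq> X" "card S = s" "\<And>x. x \<in> S \<Longrightarrow> vdegree G x \<le> s"
    and pos: "0 < s" "0 < r" and e: "0 \<le> e"
    and pw: "block_perron e s r \<theta> a b c d"
    and g: "\<And>v. v \<in> verts G \<Longrightarrow> 0 \<le> g v" and v0: "v0 \<in> verts G" "g v0 \<noteq> 0"
    and ineq: "\<And>v. v \<in> verts G \<Longrightarrow> \<mu> * g v \<le> e * vdegree G v * g v + sum g (nbrs G v)"
  shows "\<mu> \<le> \<theta>"
    and "\<mu> = \<theta> \<Longrightarrow> \<exists>T\<subseteq>Y. card T = s \<and> (\<forall>x\<in>X. nbrs G x = (if x \<in> S then T else Y))"
proof -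
  have V: "verts G = X \<union> Y" and dis: "X \<inter> Y = {}" using bip by (auto simp: bipartition_def)
  have fin: "finite X" "finite Y" using bipartition_finite[OF bip] by auto
  have finS: "finite S" using S(1) fin by (auto intro: finite_subset)
  have nX: "nbrs G x \<subseteq> Y" if "x \<in> X" for x using bipartition_nbrs[OF bip that] .
  have nY: "nbrs G y \<subseteq> X" if "y \<in> Y" for y
    using bipartition_nbrs[OF bipartition_commute[OF bip] that] .
  have gX: "0 \<le> g x" if "x \<in> X" for x using g that V by auto
  have gY: "0 \<le> g y" if "y \<in> Y" for y using g that V by auto
  obtain T where T: "T \<subseteq> Y" "card T = s" and Tmax: "\<And>A. A \<subseteq> Y \<Longrightarrow> card A \<le> s \<Longrightarrow> sum g A \<le> sum g T"
    using heaviest_subset_exists[OF fin(2), of s g] cY gY by auto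
  have finT: "finite T" using T(1) fin by (auto intro: finite_subset)
  have cXS: "card (X - S) = r" using S cX finS by (simp add: card_Diff_subset)
  define P Q R U where "P = sum g S" and "Q = sum g (X - S)" and "R = sum g T" and "U = sum g Y"
  have PQ: "sum g X = P + Q" unfolding P_def Q_def using S fin by (metis add.commute sum.subset_diff)
  have nn: "0 \<le> P" "0 \<le> Q" "0 \<le> R" "R \<le> U"
    unfolding P_def Q_def R_def U_def
    using S T gX gY fin by (auto intro!: sum_nonneg sum_mono2)
  have nz: "0 < P + Q + U"
  proof -
    have "0 < g v0" using g v0 by fastforce
    moreover have "v0 \<in> X \<or> v0 \<in> Y" using v0 V by auto
    ultimately have "0 < sum g X \<or> 0 < sum g Y"
      using fin gX gY by (meson sum_pos2)
    moreover have "0 \<le> sum g X" "0 \<le> sum g Y" using gX gY by (auto intro: sum_nonneg)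
    ultimately show ?thesis using PQ unfolding U_def by linarith
  qed
  have degX: "vdegree G x \<le> s + r" if "x \<in> X" for x
    unfolding vdegree_eq_card_nbrs using card_mono[OF fin(2) nX[OF that]] cY by simp
  have degY: "vdegree G y \<le> s + r" if "y \<in> Y" for y
    unfolding vdegree_eq_card_nbrs using card_mono[OF fin(1) nY[OF that]] cX by simp
  have nR: "sum g (nbrs G x) \<le> R" if "x \<in> S" for x
    unfolding R_def using that S nX by (intro Tmax) (auto simp flip: vdegree_eq_card_nbrs)
  have nU: "sum g (nbrs G x) \<le> U" if "x \<in> X" for x
    unfolding U_def using nX[OF that] fin gY by (intro sum_mono2) auto
  have nPQ: "sum g (nbrs G y) \<le> P + Q" if "y \<in> Y" for y
    unfolding PQ[symmetric] using nY[OF that] fin gX by (intro sum_mono2) auto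
  have S_le: "\<mu> * g x \<le> e * s * g x + R" if x: "x \<in> S" for x
  proof -
    have "e * vdegree G x * g x \<le> e * s * g x"
      using S x gX e by (intro mult_right_mono mult_left_mono) auto
    then show ?thesis using ineq[of x] nR[OF x] S x V by fastforce
  qed
  have X_le: "\<mu> * g x \<le> e * real (s + r) * g x + U" if x: "x \<in> X" for x
  proof -
    have "e * vdegree G x * g x \<le> e * real (s + r) * g x"
      using x gX e degX by (intro mult_right_mono mult_left_mono) (auto simp del: of_nat_add)
    then show ?thesis using ineq[of x] nU[OF x] x V by fastforce
  qed
  have T_le: "\<mu> * g y \<le> e * real (s + r) * g y + (P + Q)" if y: "y \<in> T" for y
  proof -
    have "e * vdegree G y * g y \<le> e * real (s + r) * g y"
      using y T gY e degY by (intro mult_right_mono mult_left_mono) (auto simp del: of_nat_add)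
    then show ?thesis using ineq[of y] nPQ[of y] y T V by fastforce
  qed
  have sumS: "(\<Sum>x\<in>S. e * s * g x + R) = s * (e * P + R)"
    by (simp add: sum.distrib S(2) P_def sum_distrib_left algebra_simps)
  have i1: "\<mu> * P \<le> s * (e * P + R)"
  proof -
    have "\<mu> * P \<le> (\<Sum>x\<in>S. e * s * g x + R)"
      unfolding P_def sum_distrib_left by (intro sum_mono S_le)
    also note sumS
    finally show ?thesis .
  qed
  have sumXS: "(\<Sum>x\<in>X - S. e * real (s + r) * g x + U) = e * real (s + r) * Q + r * U"
    by (simp add: sum.distrib cXS Q_def sum_distrib_left)
  have i2: "\<mu> * Q \<le> e * real (s + r) * Q + r * U"
  proof -
    have "\<mu> * Q \<le> (\<Sum>x\<in>X - S. e * real (s + r) * g x + U)"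
      unfolding Q_def sum_distrib_left by (intro sum_mono X_le) auto
    also note sumXS
    finally show ?thesis .
  qed
  have sumT: "(\<Sum>y\<in>T. e * real (s + r) * g y + (P + Q)) = e * real (s + r) * R + s * (P + Q)"
    by (simp add: sum.distrib T(2) R_def sum_distrib_left)
  have i3: "\<mu> * R \<le> e * real (s + r) * R + s * (P + Q)"
  proof -
    have "\<mu> * R \<le> (\<Sum>y\<in>T. e * real (s + r) * g y + (P + Q))"
      unfolding R_def sum_distrib_left by (intro sum_mono T_le)
    also note sumT
    finally show ?thesis .
  qed
  have i4_edges: "\<mu> * U \<le> e * (s * R + r * U) + (\<Sum>x\<in>X. g x * vdegree G x)"
  proof -
    have "\<mu> * U \<le> (\<Sum>y\<in>Y. e * vdegree G y * g y + sum g (nbrs G y))"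
      unfolding U_def sum_distrib_left using V by (intro sum_mono ineq) auto
    also have "\<dots> = e * (\<Sum>y\<in>Y. g y * vdegree G y) + (\<Sum>y\<in>Y. sum g (nbrs G y))"
      by (simp add: sum.distrib sum_distrib_left mult_ac)
    also have "\<dots> = e * (\<Sum>x\<in>X. sum g (nbrs G x)) + (\<Sum>x\<in>X. g x * vdegree G x)"
      using degree_sum[OF bip, of g] degree_sum[OF bipartition_commute[OF bip], of g] by simp
    also have "(\<Sum>x\<in>X. sum g (nbrs G x)) = (\<Sum>x\<in>X - S. sum g (nbrs G x)) + (\<Sum>x\<in>S. sum g (nbrs G x))"
      using S(1) fin(1) by (rule sum.subset_diff)
    also have "\<dots> \<le> (\<Sum>x\<in>X - S. U) + (\<Sum>x\<in>S. R)"
      using nU nR by (intro add_mono sum_mono) auto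
    also have "\<dots> = s * R + r * U" using S(2) cXS by simp
    finally show ?thesis using e by (simp add: mult_left_mono)
  qed
  \<comment> \<open>The degrees that the vertices of \<open>X\<close> have in the extremal graph.\<close>
  let ?cap = "\<lambda>x. if x \<in> S then s else s + r"
  have cap: "vdegree G x \<le> ?cap x" if "x \<in> X" for x using S degX that by auto
  have cap_le: "g x * vdegree G x \<le> g x * ?cap x" if "x \<in> X" for x
    using gX[OF that] cap[OF that] by (intro mult_left_mono) (simp_all only: of_nat_le_iff)
  have cap_sum_le: "(\<Sum>x\<in>X. g x * vdegree G x) \<le> (\<Sum>x\<in>X. g x * ?cap x)"
    by (rule sum_mono[OF cap_le])
  have cap_sum: "(\<Sum>x\<in>X. g x * ?cap x) = s * P + real (s + r) * Q"
  proof -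
    have "(\<Sum>x\<in>X. g x * ?cap x) = (\<Sum>x\<in>X - S. g x * ?cap x) + (\<Sum>x\<in>S. g x * ?cap x)"
      using S(1) fin(1) by (rule sum.subset_diff)
    also have "\<dots> = (\<Sum>x\<in>X - S. real (s + r) * g x) + (\<Sum>x\<in>S. s * g x)"
      by (intro arg_cong2[of _ _ _ _ "(+)"] sum.cong) auto
    finally show ?thesis by (simp only: P_def Q_def sum_distrib_left add.commute)
  qed
  have i4: "\<mu> * U \<le> e * (s * R + r * U) + s * P + real (s + r) * Q"
    using i4_edges cap_sum_le cap_sum by linarith
  show "\<mu> \<le> \<theta>"
    by (rule block_perron_comparison(1)[OF pw pos e nn nz i1 i2 i3 i4])
  assume "\<mu> = \<theta>"
  then have R: "0 < R" and U: "0 < U" and e1: "\<mu> * P = s * (e * P + R)"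
    and e2: "\<mu> * Q = e * real (s + r) * Q + r * U"
    and e3: "\<mu> * R = e * real (s + r) * R + s * (P + Q)"
    and e4: "\<mu> * U = e * (s * R + r * U) + s * P + real (s + r) * Q"
    using block_perron_comparison(2)[OF pw pos e nn nz i1 i2 i3 i4] by blast+
  have pS: "0 < g x" if x: "x \<in> S" for x
  proof -
    have "(\<Sum>x\<in>S. \<mu> * g x) = (\<Sum>x\<in>S. e * s * g x + R)"
      unfolding sumS using e1 by (simp only: P_def sum_distrib_left)
    then have "\<mu> * g x = e * s * g x + R" using S_le x finS by (rule sum_mono_inv)
    then have "g x \<noteq> 0" using R by auto
    then show ?thesis using gX[of x] x S by auto
  qed
  have pXS: "0 < g x" if x: "x \<in> X - S" for x
  proof -
    have "(\<Sum>x\<in>X - S. \<mu> * g x) = (\<Sum>x\<in>X - S. e * real (s + r) * g x + U)"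
      unfolding sumXS using e2 by (simp only: Q_def sum_distrib_left)
    then have "\<mu> * g x = e * real (s + r) * g x + U"
      by (rule sum_mono_inv) (use X_le x fin in auto)
    then have "g x \<noteq> 0" using U by auto
    then show ?thesis using gX[of x] x by auto
  qed
  have pX: "0 < g x" if "x \<in> X" for x using pS pXS that by blast
  have nT: "nbrs G y = X" if y: "y \<in> T" for y
  proof -
    have yY: "y \<in> Y" using y T by auto
    have "(\<Sum>y\<in>T. \<mu> * g y) = (\<Sum>y\<in>T. e * real (s + r) * g y + (P + Q))"
      unfolding sumT using e3 by (simp only: R_def sum_distrib_left)
    then have "\<mu> * g y = e * real (s + r) * g y + (P + Q)" using T_le y finT by (rule sum_mono_inv)
    moreover have "\<mu> * g y \<le> e * real (s + r) * g y + sum g (nbrs G y)"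
    proof -
      have "e * vdegree G y * g y \<le> e * real (s + r) * g y"
        using yY gY e degY by (intro mult_right_mono mult_left_mono) (auto simp del: of_nat_add)
      then show ?thesis using ineq[of y] yY V by fastforce
    qed
    ultimately have "sum g X \<le> sum g (nbrs G y)" using PQ by linarith
    moreover have "sum g X = sum g (X - nbrs G y) + sum g (nbrs G y)"
      using nY[OF yY] fin(1) by (rule sum.subset_diff)
    ultimately have le0: "sum g (X - nbrs G y) \<le> 0" by linarith
    have "X - nbrs G y = {}"
    proof (rule ccontr)
      assume "X - nbrs G y \<noteq> {}"
      then have "0 < sum g (X - nbrs G y)" using fin pX by (intro sum_pos) auto
      with le0 show False by linarith
    qed
    then show ?thesis using nY[OF yY] by blast
  qed
  have degX_eq: "vdegree G x = ?cap x" if x: "x \<in> X" for x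
  proof -
    have "(\<Sum>x\<in>X. g x * vdegree G x) = (\<Sum>x\<in>X. g x * ?cap x)"
      using i4_edges e4 cap_sum cap_sum_le by linarith
    then have "g x * vdegree G x = g x * ?cap x" using cap_le x fin(1) by (rule sum_mono_inv)
    then show ?thesis using pX[OF x] by (simp only: mult_cancel_left of_nat_eq_iff) simp
  qed
  have "nbrs G x = (if x \<in> S then T else Y)" if x: "x \<in> X" for x
  proof (cases "x \<in> S")
    case True
    \<comment> \<open>\<open>T\<close> has as many elements as \<open>x\<close> may have neighbours, so there are no others.\<close>
    have "T \<subseteq> nbrs G x"
    proof
      fix y assume y: "y \<in> T"
      then have "y \<in> verts G" using T V by auto
      moreover have "x \<in> nbrs G y" using nT[OF y] x by simp
      ultimately show "y \<in> nbrs G x" by (rule nbrs_sym)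
    qed
    moreover have "card (nbrs G x) = card T"
      using degX_eq[OF x] True T by (simp add: vdegree_eq_card_nbrs)
    moreover have "finite (nbrs G x)" using nX[OF x] fin by (auto intro: finite_subset)
    ultimately show ?thesis using True card_subset_eq[of "nbrs G x" T] by simp
  next
    case False
    have "card (nbrs G x) = card Y"
      using degX_eq[OF x] False cY by (simp add: vdegree_eq_card_nbrs)
    then show ?thesis using False card_subset_eq[OF fin(2) nX[OF x]] by simp
  qed
  with T show "\<exists>T\<subseteq>Y. card T = s \<and> (\<forall>x\<in>X. nbrs G x = (if x \<in> S then T else Y))" by blast
qed

section \<open>Hamilton cycles in balanced bipartite graphs\<close>

text \<open>In contrast to an indexed description modulo the length, this form splits along appended lists, which
is how cycles are rotated, cut and reconnected below.\<close>

definition closed_path :: "'a set set \<Rightarrow> 'a list \<Rightarrow> bool" where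
  "closed_path E c \<longleftrightarrow> successively (\<lambda>u v. {u, v} \<in> E) c \<and> {last c, hd c} \<in> E"

lemma hamilton_cycle_iff_closed_path:
  "hamilton_cycle G c \<longleftrightarrow>
     3 \<le> length c \<and> distinct c \<and> set c = verts G \<and> closed_path (edges G) c"
proof (cases "c = []")
  case False
  define m where "m = length c - 1"
  have len: "length c = Suc m" using False by (simp add: m_def)
  have "(\<forall>i<length c. {c ! i, c ! (Suc i mod length c)} \<in> edges G) \<longleftrightarrow>
      (\<forall>i<m. {c ! i, c ! (Suc i mod length c)} \<in> edges G) \<and> {c ! m, c ! (Suc m mod length c)} \<in> edges G"
    unfolding len less_Suc_eq by blast
  also have "\<dots> \<longleftrightarrow> (\<forall>i<m. {c ! i, c ! Suc i} \<in> edges G) \<and> {last c, hd c} \<in> edges G"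
    using False by (simp add: len last_conv_nth hd_conv_nth)
  also have "\<dots> \<longleftrightarrow> closed_path (edges G) c"
    by (auto simp: closed_path_def successively_conv_nth len)
  finally show ?thesis by (auto simp: hamilton_cycle_def)
qed (simp add: hamilton_cycle_def)

lemma closed_path_rotate:
  assumes "closed_path E (us @ vs)"
  shows "closed_path E (vs @ us)"
  using assms by (cases "us = []"; cases "vs = []") (auto simp: closed_path_def successively_append_iff)

text \<open>A Hamilton cycle that needs the edge \<open>{x, y}\<close> can be cut open there, leaving a Hamilton
  path from \<open>x\<close> to \<open>y\<close> in the original edge set.\<close>

lemma hamilton_path_from_new_edge:
  assumes ham: "closed_path (insert {x, y} E) c" and no: "\<not> closed_path E c"
    and c: "distinct c" "3 \<le> length c"
  obtains c' where "distinct c'" "set c' = set c" "length c' = length c"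
    "successively (\<lambda>u v. {u, v} \<in> E) c'" "hd c' = x" "last c' = y"
proof -
  let ?E = "insert {x, y} E"
  have ne: "c \<noteq> []" using c by auto
  obtain d where d: "closed_path ?E d" "mset d = mset c" "{last d, hd d} = {x, y}"
  proof (cases "{last c, hd c} \<in> E")
    case True
    then have "\<not> successively (\<lambda>u v. {u, v} \<in> E) c" using no by (simp add: closed_path_def)
    then obtain i where i: "Suc i < length c" "{c ! i, c ! Suc i} \<notin> E"
      by (auto simp: successively_conv_nth)
    let ?u = "take (Suc i) c" and ?v = "drop (Suc i) c"
    have uv: "?u \<noteq> []" "?v \<noteq> []" using i by auto
    have "closed_path ?E (?v @ ?u)" using ham by (simp add: closed_path_rotate[of _ ?u ?v])
    moreover have "mset (?v @ ?u) = mset c"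
    proof -
      have "mset (?v @ ?u) = mset (?u @ ?v)" unfolding mset_append by (rule add.commute)
      then show ?thesis by (simp only: append_take_drop_id)
    qed
    moreover have "{last (?v @ ?u), hd (?v @ ?u)} = {x, y}"
    proof -
      have "last (?v @ ?u) = c ! i" using uv i by (simp add: take_Suc_conv_app_nth)
      moreover have "hd (?v @ ?u) = c ! Suc i" using uv i by (simp add: hd_drop_conv_nth)
      moreover have "{c ! i, c ! Suc i} \<in> ?E"
        using ham i by (auto simp: closed_path_def successively_conv_nth)
      ultimately show ?thesis using i by simp
    qed
    ultimately show thesis by (rule that)
  next
    case False
    then show thesis using ham by (intro that[of c]) (auto simp: closed_path_def)
  qed
  have dc: "distinct d" "set d = set c" "length d = length c"
    using d(2) c(1) mset_eq_imp_distinct_iff mset_eq_setD mset_eq_length by blast+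
  have dne: "d \<noteq> []" using dc ne by auto
  have "successively (\<lambda>u v. {u, v} \<in> E) d"
    unfolding successively_conv_nth
  proof (intro allI impI)
    fix i assume i: "Suc i < length d"
    have "{d ! i, d ! Suc i} \<in> ?E" using d(1) i by (auto simp: closed_path_def successively_conv_nth)
    moreover have "{d ! i, d ! Suc i} \<noteq> {x, y}"
    proof
      assume "{d ! i, d ! Suc i} = {x, y}"
      then have "{d ! i, d ! Suc i} = {d ! (length d - 1), d ! 0}"
        using d(3) dne by (simp add: last_conv_nth hd_conv_nth)
      then have "(d ! i = d ! (length d - 1) \<and> d ! Suc i = d ! 0) \<or>
          (d ! i = d ! 0 \<and> d ! Suc i = d ! (length d - 1))"
        by (auto simp: doubleton_eq_iff)
      moreover have eqs: "d ! Suc i = d ! 0 \<longleftrightarrow> Suc i = 0" "d ! i = d ! 0 \<longleftrightarrow> i = 0"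
          "d ! Suc i = d ! (length d - 1) \<longleftrightarrow> Suc i = length d - 1"
        using i dc(1) dne by (simp_all add: nth_eq_iff_index_eq)
      ultimately have "Suc i = 0 \<or> (i = 0 \<and> Suc i = length d - 1)"
        using eqs by blast
      then show False using dc(3) c(2) by linarith
    qed
    ultimately show "{d ! i, d ! Suc i} \<in> E" by simp
  qed
  note path = this
  show thesis
  proof (cases "hd d = x")
    case True
    then have "last d = y" using d(3) by (auto simp: doubleton_eq_iff)
    with True show thesis using dc path by (intro that[of d]) auto
  next
    case False
    then have "hd d = y" "last d = x" using d(3) by (auto simp: doubleton_eq_iff)
    then show thesis using dc path dne
      by (intro that[of "rev d"]) (auto simp: hd_rev last_rev insert_commute)
  qed
qed

text \<open>If \<open>x\<close> were joined to the successor and \<open>y\<close> to the predecessor of the same edge of the path,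
  the two pieces of the path could be reconnected to a cycle.\<close>

lemma crossing_chords_close_path:
  assumes path: "successively (\<lambda>u v. {u, v} \<in> E) c"
    and j: "Suc j < length c" and chords: "{hd c, c ! Suc j} \<in> E" "{last c, c ! j} \<in> E"
  shows "closed_path E (take (Suc j) c @ rev (drop (Suc j) c))"
proof -
  let ?u = "take (Suc j) c" and ?v = "drop (Suc j) c"
  have uv: "?u \<noteq> []" "?v \<noteq> []" using j by auto
  have "successively (\<lambda>u v. {u, v} \<in> E) (?u @ ?v)" using path by simp
  then have "successively (\<lambda>u v. {u, v} \<in> E) ?u" "successively (\<lambda>u v. {u, v} \<in> E) ?v"
    by (auto simp only: successively_append_iff)
  moreover have "last ?u = c ! j" using j by (simp add: take_Suc_conv_app_nth)
  moreover have "hd ?v = c ! Suc j" using j by (simp add: hd_drop_conv_nth)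
  moreover have "last ?v = last c" using j by simp
  moreover have "hd ?u = hd c" using uv by simp
  ultimately show ?thesis
    using chords uv unfolding closed_path_def
    by (simp add: successively_append_iff hd_rev last_rev insert_commute)
qed

lemma complete_bipartite_hamiltonian:
  assumes X: "finite X" "card X = n" and Y: "finite Y" "card Y = n" and dis: "X \<inter> Y = {}"
    and n: "2 \<le> n" and V: "V = X \<union> Y" and E: "\<And>x y. x \<in> X \<Longrightarrow> y \<in> Y \<Longrightarrow> {x, y} \<in> E"
  shows "hamiltonian (Graph V E)"
proof -
  obtain f g where f: "bij_betw f {0..<n} X" and g: "bij_betw g {0..<n} Y"
    using ex_bij_betw_nat_finite[OF X(1)] ex_bij_betw_nat_finite[OF Y(1)] X Y by metis
  define h where "h i = (if even i then f (i div 2) else g (i div 2))" for i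
  define c where "c = map h [0..<2 * n]"
  have len: "length c = 2 * n" by (simp add: c_def)
  have hX: "h i \<in> X" if "even i" "i < 2 * n" for i
    using that bij_betw_apply[OF f, of "i div 2"] by (auto simp: h_def)
  have hY: "h i \<in> Y" if "odd i" "i < 2 * n" for i
    using that bij_betw_apply[OF g, of "i div 2"] by (auto simp: h_def)
  have inj: "inj_on h {0..<2 * n}"
  proof (rule inj_onI)
    fix i j assume ij: "i \<in> {0..<2 * n}" "j \<in> {0..<2 * n}" "h i = h j"
    have par: "even i \<longleftrightarrow> even j" using ij hX hY dis by (metis atLeastLessThan_iff disjoint_iff)
    have "i div 2 \<in> {0..<n}" "j div 2 \<in> {0..<n}" using ij by auto
    moreover have "f (i div 2) = f (j div 2) \<or> g (i div 2) = g (j div 2)"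
      using ij(3) par unfolding h_def by (metis (full_types))
    ultimately have "i div 2 = j div 2"
      using f g unfolding bij_betw_def by (blast dest: inj_onD)
    then show "i = j" using par by (metis even_two_times_div_two odd_two_times_div_two_succ)
  qed
  have "distinct c" using inj by (simp add: c_def distinct_map)
  moreover have "set c = V"
  proof (rule card_subset_eq)
    show "finite V" using V X Y by simp
    show "set c \<subseteq> V"
    proof
      fix v assume "v \<in> set c"
      then obtain i where "i < 2 * n" "v = h i" by (auto simp: c_def)
      then show "v \<in> V" using hX[of i] hY[of i] V by blast
    qed
    show "card (set c) = card V"
      using distinct_card[OF \<open>distinct c\<close>] len V X Y dis by (simp add: card_Un_disjoint)
  qed
  moreover have "\<forall>i<length c. {c ! i, c ! (Suc i mod length c)} \<in> E"
  proof (intro allI impI)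
    fix i assume i: "i < length c"
    let ?j = "Suc i mod length c"
    have j: "?j < length c" using i by (intro mod_less_divisor) linarith
    have par: "even ?j \<longleftrightarrow> odd i" unfolding len by (subst dvd_mod_iff) simp_all
    have "c ! i = h i" "c ! ?j = h ?j" using i j by (simp_all add: c_def)
    moreover have "{h i, h ?j} \<in> E"
    proof (cases "even i")
      case True
      then show ?thesis using E[OF hX[of i] hY[of ?j]] par i j len by simp
    next
      case False
      then show ?thesis using E[OF hX[of ?j] hY[of i]] par i j len by (simp add: insert_commute)
    qed
    ultimately show "{c ! i, c ! ?j} \<in> E" by simp
  qed
  ultimately show ?thesis
    using n len unfolding hamiltonian_def hamilton_cycle_def by (intro exI[of _ c]) simp
qed

text \<open>\<open>A\<close> consists of the predecessors, along the path, of the neighbours of its first vertex.  The path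
alternates between the sides, so \<open>A\<close> lies on the side of that vertex; an edge from \<open>A\<close> to the last
vertex would give the crossing chords of \<open>crossing_chords_close_path\<close>.\<close>

lemma hamilton_path_end_shifts:
  assumes bip: "bipartition H X Y" and no: "\<not> hamiltonian H"
    and c: "distinct c" "set c = verts H" "3 \<le> length c"
    and path: "successively (\<lambda>u v. {u, v} \<in> edges H) c" and x: "hd c \<in> X"
  obtains A where "A \<subseteq> X" "card A = vdegree H (hd c)" "\<And>a. a \<in> A \<Longrightarrow> {a, last c} \<notin> edges H"
proof -
  define J where "J = {j. Suc j < length c \<and> {hd c, c ! Suc j} \<in> edges H}"
  have V: "verts H = X \<union> Y" "X \<inter> Y = {}" using bip by (auto simp: bipartition_def)
  have edgeX: "w \<in> Y" if "{u, w} \<in> edges H" "u \<in> X" for u w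
    using that bip V by (fastforce simp: bipartition_def doubleton_eq_iff)
  have edgeY: "w \<in> X" if "{w, u} \<in> edges H" "u \<in> Y" for u w
    using that bip V by (fastforce simp: bipartition_def doubleton_eq_iff)
  have "nbrs H (hd c) = (\<lambda>j. c ! Suc j) ` J"
  proof
    show "nbrs H (hd c) \<subseteq> (\<lambda>j. c ! Suc j) ` J"
    proof
      fix w assume w: "w \<in> nbrs H (hd c)"
      then have "w \<in> set c" using c(2) by (simp add: nbrs_def)
      then obtain i where i: "i < length c" "w = c ! i" by (auto simp: in_set_conv_nth)
      have "i \<noteq> 0"
      proof
        assume "i = 0"
        then have "w = hd c" using i c by (metis hd_conv_nth list.size(3) not_less_zero)
        then show False using w x V edgeX[of "hd c" w] by (auto simp: nbrs_def)
      qed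
      then obtain j where "i = Suc j" by (cases i) auto
      then show "w \<in> (\<lambda>j. c ! Suc j) ` J" using i w by (auto simp: J_def nbrs_def)
    qed
    show "(\<lambda>j. c ! Suc j) ` J \<subseteq> nbrs H (hd c)" using c(2) by (force simp: J_def nbrs_def)
  qed
  moreover have "inj_on (\<lambda>j. c ! Suc j) J" "inj_on (\<lambda>j. c ! j) J"
    using c(1) by (auto intro!: inj_onI simp: J_def nth_eq_iff_index_eq)
  ultimately have "card ((\<lambda>j. c ! j) ` J) = vdegree H (hd c)"
    by (simp add: vdegree_eq_card_nbrs card_image)
  moreover have "(\<lambda>j. c ! j) ` J \<subseteq> X"
  proof clarify
    fix j assume j: "j \<in> J"
    then have "c ! Suc j \<in> Y" using edgeX x by (auto simp: J_def)
    moreover have "{c ! j, c ! Suc j} \<in> edges H"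
      using path j by (auto simp: J_def successively_conv_nth)
    ultimately show "c ! j \<in> X" using edgeY by blast
  qed
  moreover have "{a, last c} \<notin> edges H" if "a \<in> (\<lambda>j. c ! j) ` J" for a
  proof
    assume a: "{a, last c} \<in> edges H"
    from that obtain j where j: "Suc j < length c" "{hd c, c ! Suc j} \<in> edges H" "a = c ! j"
      by (auto simp: J_def)
    let ?c = "take (Suc j) c @ rev (drop (Suc j) c)"
    have "closed_path (edges H) ?c"
      using crossing_chords_close_path[OF path j(1,2)] a j(3) by (simp add: insert_commute)
    moreover have "mset ?c = mset c" by (metis append_take_drop_id mset_append mset_rev)
    then have "distinct ?c" "set ?c = verts H" "length ?c = length c"
      using c mset_eq_imp_distinct_iff mset_eq_setD mset_eq_length by blast+
    ultimately have "hamilton_cycle H ?c"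
      unfolding hamilton_cycle_iff_closed_path using c(3) by simp
    then show False using no unfolding hamiltonian_def by blast
  qed
  ultimately show thesis using that[of "(\<lambda>j. c ! j) ` J"] by blast
qed

text \<open>This is the theorem of Moon and Moser, in contrapositive form.  The degrees are compared in an
edge-maximal non-Hamiltonian supergraph \<open>H\<close> with the same bipartition; since degrees only drop when
passing back to \<open>G\<close>, the bound survives.  The last conclusion, which also holds when \<open>S\<close> is empty,
relates \<open>s\<close> to the minimum degree of \<open>G\<close>.\<close>

lemma nonhamiltonian_low_degree_set:
  assumes bal: "balanced_bipartite n G" and no: "\<not> hamiltonian G" and n: "2 \<le> n"
  obtains X Y S s where "bipartition G X Y" "card X = n" "card Y = n" "S \<subseteq> X" "card S = s"
    "2 * s \<le> n" "\<And>x. x \<in> S \<Longrightarrow> vdegree G x \<le> s" "\<exists>v\<in>verts G. vdegree G v \<le> s"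
proof -
  obtain X Y where bip: "bipartition G X Y" and X: "card X = n" and Y: "card Y = n"
    using bal by (auto simp: balanced_bipartite_bipartition)
  have V: "verts G = X \<union> Y" "X \<inter> Y = {}" using bip by (auto simp: bipartition_def)
  have fin: "finite X" "finite Y" using bipartition_finite[OF bip] by auto
  have finV: "finite (verts G)" using V fin by simp
  define K where "K = (\<lambda>(x, y). {x, y}) ` (X \<times> Y)"
  define F where "F = {E'. edges G \<subseteq> E' \<and> E' \<subseteq> K \<and> \<not> hamiltonian (Graph (verts G) E')}"
  have "finite F"
    by (rule finite_subset[of _ "Pow K"]) (auto simp: F_def K_def fin)
  moreover have "edges G \<in> F"
    using bip no by (cases G) (auto simp: F_def K_def bipartition_def)
  ultimately obtain E where E: "E \<in> F" "edges G \<subseteq> E" and Emax: "\<And>E'. E' \<in> F \<Longrightarrow> E \<subseteq> E' \<Longrightarrow> E = E'"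
    using finite_has_maximal2 by metis
  define H where "H = Graph (verts G) E"
  have H: "verts H = verts G" "edges H = E" by (simp_all add: H_def)
  have noH: "\<not> hamiltonian H" using E by (simp add: F_def H_def)
  have EK: "E \<subseteq> K" using E by (simp add: F_def)
  have bipH: "bipartition H X Y"
    unfolding bipartition_def fin_simple_graph_def H
  proof (intro conjI ballI V finV)
    fix e assume "e \<in> E"
    then obtain x y where e: "x \<in> X" "y \<in> Y" "e = {x, y}" using EK by (auto simp: K_def)
    then show "\<exists>x\<in>X. \<exists>y\<in>Y. e = {x, y}" by blast
    show "e \<subseteq> verts G" using e V by auto
    have "x \<noteq> y" using e V by auto
    then show "card e = 2" by (simp add: e(3))
  qed
  define NP where "NP = {(x, y). x \<in> X \<and> y \<in> Y \<and> {x, y} \<notin> E}"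
  let ?D = "\<lambda>(x, y). vdegree H x + vdegree H y"
  have "finite NP" by (rule finite_subset[of _ "X \<times> Y"]) (auto simp: NP_def fin)
  moreover have "NP \<noteq> {}"
    using complete_bipartite_hamiltonian[OF fin(1) X fin(2) Y V(2) n V(1), of E] noH
    by (auto simp: NP_def H_def)
  ultimately have "Max (?D ` NP) \<in> ?D ` NP" and finD: "finite (?D ` NP)" by simp_all
  then obtain q where q: "q \<in> NP" "?D q = Max (?D ` NP)" by auto
  obtain x y where xy: "q = (x, y)" by (cases q)
  have xX: "x \<in> X" and yY: "y \<in> Y" and nxy: "{x, y} \<notin> E" using q(1) by (auto simp: xy NP_def)
  have qmax: "vdegree H x' + vdegree H y' \<le> vdegree H x + vdegree H y"
    if "x' \<in> X" "y' \<in> Y" "{x', y'} \<notin> E" for x' y'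
  proof -
    have "(x', y') \<in> NP" using that by (simp add: NP_def)
    then have "?D (x', y') \<le> Max (?D ` NP)" using finD by (intro Max_ge) auto
    then show ?thesis using q(2) by (simp add: xy)
  qed
  have "hamiltonian (Graph (verts G) (insert {x, y} E))"
  proof (rule ccontr)
    assume "\<not> ?thesis"
    then have "insert {x, y} E \<in> F" using E(1) xX yY by (auto simp: F_def K_def)
    then show False using Emax[of "insert {x, y} E"] nxy by auto
  qed
  then obtain c where c: "3 \<le> length c" "distinct c" "set c = verts G" "closed_path (insert {x, y} E) c"
    by (auto simp: hamiltonian_def hamilton_cycle_iff_closed_path)
  have "\<not> closed_path E c"
    using noH c by (auto simp: hamiltonian_def hamilton_cycle_iff_closed_path H)
  then obtain d where d: "distinct d" "set d = verts H" "3 \<le> length d"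
    "successively (\<lambda>u v. {u, v} \<in> edges H) d" "hd d = x" "last d = y"
    using hamilton_path_from_new_edge[OF c(4) _ c(2,1)] c H by metis
  obtain A where A: "A \<subseteq> X" "card A = vdegree H x" "\<And>a. a \<in> A \<Longrightarrow> {a, y} \<notin> E"
    using hamilton_path_end_shifts[OF bipH noH d(1-4)] d(5,6) xX H by metis
  have dr: "distinct (rev d)" "set (rev d) = verts H" "3 \<le> length (rev d)"
    "successively (\<lambda>u v. {u, v} \<in> edges H) (rev d)" "hd (rev d) = y" "last (rev d) = x"
    using d by (simp_all add: insert_commute hd_rev last_rev)
  obtain B where B: "B \<subseteq> Y" "card B = vdegree H y" "\<And>b. b \<in> B \<Longrightarrow> {b, x} \<notin> E"
    using hamilton_path_end_shifts[OF bipartition_commute[OF bipH] noH dr(1-4)] dr(5,6) yY H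
    by metis
  \<comment> \<open>Replacing \<open>x\<close> by \<open>a\<close>, or \<open>y\<close> by \<open>b\<close>, gives another non-adjacent pair, whose degree sum is not larger.\<close>
  have degA: "vdegree H a \<le> vdegree H x" if "a \<in> A" for a
    using qmax[of a y] A that yY by auto
  have degB: "vdegree H b \<le> vdegree H y" if "b \<in> B" for b
    using qmax[of x b] B that xX by (auto simp: insert_commute)
  have GH: "vdegree G v \<le> vdegree H v" for v
    unfolding vdegree_def H using E(2) finV by (intro card_mono) auto
  have "nbrs H y \<subseteq> X - A"
    using bipartition_nbrs[OF bipartition_commute[OF bipH] yY] A(3) H
    by (auto simp: nbrs_def insert_commute)
  then have "vdegree H y \<le> card (X - A)"
    unfolding vdegree_eq_card_nbrs using fin by (intro card_mono) auto
  also have "\<dots> = n - vdegree H x"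
    using A fin X by (metis card_Diff_subset finite_subset)
  finally have "vdegree H y \<le> n - vdegree H x" .
  moreover have "vdegree H x \<le> n" using A X fin by (metis card_mono)
  ultimately have sum: "vdegree H x + vdegree H y \<le> n" by linarith
  show thesis
  proof (cases "2 * vdegree H x \<le> n")
    case True
    show thesis
      by (rule that[OF bip X Y A(1,2) True])
        (use GH degA xX V le_trans in blast)+
  next
    case False
    with sum have "2 * vdegree H y \<le> n" by linarith
    show thesis
      by (rule that[OF bipartition_commute[OF bip] Y X B(1,2) \<open>2 * vdegree H y \<le> n\<close>])
        (use GH degB yY V le_trans in blast)+
  qed
qed

section \<open>Spectra as equations on vertex functions\<close>

text \<open>Matrices are indexed by positions in the sorted list of vertices; this removes the positions once and
for all.\<close>

lemma eigenvalue_iff_vertex_function: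
  fixes F :: "'a :: linorder \<Rightarrow> 'a \<Rightarrow> 'b :: field"
  assumes V: "finite V"
    and A: "A = mat (card V) (card V) (\<lambda>(i, j). F (sorted_list_of_set V ! i) (sorted_list_of_set V ! j))"
  shows "eigenvalue A \<mu> \<longleftrightarrow>
    (\<exists>f. (\<exists>v\<in>V. f v \<noteq> 0) \<and> (\<forall>u\<in>V. (\<Sum>w\<in>V. F u w * f w) = \<mu> * f u))"
proof -
  let ?vs = "sorted_list_of_set V" and ?N = "card V"
  have bij: "bij_betw (\<lambda>i. ?vs ! i) {0..<?N} V"
    using V by (intro bij_betw_nth) (auto simp: lessThan_atLeast0)
  have dim: "dim_row A = ?N" "dim_col A = ?N" by (simp_all add: A)
  have prod: "(A *\<^sub>v v) $ i = (\<Sum>w\<in>V. F (?vs ! i) w * f w)"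
    if "i < ?N" "dim_vec v = ?N" "\<And>j. j < ?N \<Longrightarrow> f (?vs ! j) = v $ j" for v f i
  proof -
    have "(A *\<^sub>v v) $ i = (\<Sum>j = 0..<?N. F (?vs ! i) (?vs ! j) * f (?vs ! j))"
      using that by (simp add: A scalar_prod_def)
    also have "\<dots> = (\<Sum>w\<in>V. F (?vs ! i) w * f w)"
      by (rule sum.reindex_bij_betw[OF bij])
    finally show ?thesis .
  qed
  have all_V: "(\<forall>u\<in>V. Q u) \<longleftrightarrow> (\<forall>i<?N. Q (?vs ! i))" for Q
    using bij_betw_imp_surj_on[OF bij] by (metis (no_types, lifting) atLeastLessThan_iff imageE imageI zero_le)
  show ?thesis
  proof
    assume "eigenvalue A \<mu>"
    then obtain v where v: "dim_vec v = ?N" "v \<noteq> 0\<^sub>v ?N" "A *\<^sub>v v = \<mu> \<cdot>\<^sub>v v"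
      unfolding eigenvalue_def eigenvector_def dim by (meson carrier_vecD)
    define f where "f u = v $ (inv_into {0..<?N} (\<lambda>i. ?vs ! i) u)" for u
    have f: "f (?vs ! j) = v $ j" if "j < ?N" for j
      using that bij by (simp add: f_def bij_betw_def inv_into_f_f)
    have "\<exists>j<?N. v $ j \<noteq> 0"
      using v(1,2) by (metis dim_vec eq_vecI index_zero_vec(1,2))
    then have "\<exists>v\<in>V. f v \<noteq> 0" using f all_V[of "\<lambda>u. f u = 0"] by auto
    moreover have "\<forall>u\<in>V. (\<Sum>w\<in>V. F u w * f w) = \<mu> * f u"
      unfolding all_V
    proof (intro allI impI)
      fix i assume i: "i < ?N"
      have "(A *\<^sub>v v) $ i = \<mu> * v $ i" using v i by simp
      then show "(\<Sum>w\<in>V. F (?vs ! i) w * f w) = \<mu> * f (?vs ! i)"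
        using prod[OF i v(1) f] f[OF i] by simp
    qed
    ultimately show "\<exists>f. (\<exists>v\<in>V. f v \<noteq> 0) \<and> (\<forall>u\<in>V. (\<Sum>w\<in>V. F u w * f w) = \<mu> * f u)" by blast
  next
    assume "\<exists>f. (\<exists>v\<in>V. f v \<noteq> 0) \<and> (\<forall>u\<in>V. (\<Sum>w\<in>V. F u w * f w) = \<mu> * f u)"
    then obtain f where f: "\<exists>v\<in>V. f v \<noteq> 0" "\<forall>u\<in>V. (\<Sum>w\<in>V. F u w * f w) = \<mu> * f u" by blast
    let ?v = "vec ?N (\<lambda>i. f (?vs ! i))"
    have "\<exists>j<?N. f (?vs ! j) \<noteq> 0" using f(1) all_V[of "\<lambda>u. f u = 0"] by auto
    then have "?v \<noteq> 0\<^sub>v ?N" by (metis index_vec index_zero_vec(1))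
    moreover have "A *\<^sub>v ?v = \<mu> \<cdot>\<^sub>v ?v"
    proof (rule eq_vecI)
      fix i assume "i < dim_vec (\<mu> \<cdot>\<^sub>v ?v)"
      then have i: "i < ?N" by simp
      then show "(A *\<^sub>v ?v) $ i = (\<mu> \<cdot>\<^sub>v ?v) $ i"
        using prod[OF i, of ?v f] f(2) all_V[of "\<lambda>u. (\<Sum>w\<in>V. F u w * f w) = \<mu> * f u"] by simp
    qed (simp add: dim)
    ultimately have "eigenvector A ?v \<mu>" by (simp add: eigenvector_def dim)
    then show "eigenvalue A \<mu>" by (auto simp: eigenvalue_def)
  qed
qed

text \<open>The maximum of a spectrum is meaningful only if the spectrum is non-empty.  Over the complex numbers
an eigenvalue \<open>z\<close> exists; symmetry makes the Hermitian form \<open>q\<close> of its eigenvector real, hence \<open>z\<close> is real,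
and the real or the imaginary part of the eigenvector is a real eigenvector.\<close>

lemma symmetric_real_eigenvalue_exists:
  fixes F :: "'a :: linorder \<Rightarrow> 'a \<Rightarrow> real"
  assumes V: "finite V" "V \<noteq> {}" and sym: "\<And>u w. F u w = F w u"
  obtains \<mu> f where "\<exists>v\<in>V. f v \<noteq> 0" "\<And>u. u \<in> V \<Longrightarrow> (\<Sum>w\<in>V. F u w * f w) = \<mu> * f u"
proof -
  define A where "A = mat (card V) (card V)
    (\<lambda>(i, j). complex_of_real (F (sorted_list_of_set V ! i) (sorted_list_of_set V ! j)))"
  have "spectrum A \<noteq> {}"
    using V by (intro spectrum_non_empty[of _ "card V"]) (auto simp: A_def card_gt_0_iff)
  then obtain z where "eigenvalue A z" by (auto simp: spectrum_def)
  then obtain h where h: "\<exists>v\<in>V. h v \<noteq> 0"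
    and eig: "\<And>u. u \<in> V \<Longrightarrow> (\<Sum>w\<in>V. complex_of_real (F u w) * h w) = z * h u"
    using eigenvalue_iff_vertex_function[OF V(1), of A "\<lambda>u w. complex_of_real (F u w)" z]
    unfolding A_def by blast
  define N where "N = (\<Sum>u\<in>V. (cmod (h u))\<^sup>2)"
  have "N > 0"
    unfolding N_def using h V by (auto intro!: sum_pos2)
  define q where "q = (\<Sum>u\<in>V. cnj (h u) * (\<Sum>w\<in>V. complex_of_real (F u w) * h w))"
  have "q = (\<Sum>u\<in>V. z * complex_of_real ((cmod (h u))\<^sup>2))"
    unfolding q_def
  proof (intro sum.cong refl)
    fix u assume u: "u \<in> V"
    have "cnj (h u) * (\<Sum>w\<in>V. complex_of_real (F u w) * h w) = z * (h u * cnj (h u))"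
      unfolding eig[OF u] by (simp only: mult_ac)
    then show "cnj (h u) * (\<Sum>w\<in>V. complex_of_real (F u w) * h w) = z * complex_of_real ((cmod (h u))\<^sup>2)"
      by (simp only: complex_norm_square)
  qed
  then have qz: "q = z * of_real N" by (simp add: N_def sum_distrib_left)
  have "cnj q = (\<Sum>u\<in>V. \<Sum>w\<in>V. h u * (complex_of_real (F u w) * cnj (h w)))"
    by (simp add: q_def sum_distrib_left)
  also have "\<dots> = (\<Sum>w\<in>V. \<Sum>u\<in>V. h u * (complex_of_real (F u w) * cnj (h w)))"
    by (rule sum.swap)
  also have "\<dots> = (\<Sum>w\<in>V. \<Sum>u\<in>V. cnj (h w) * (complex_of_real (F w u) * h u))"
  proof (intro sum.cong refl)
    fix u w
    show "h u * (complex_of_real (F u w) * cnj (h w)) = cnj (h w) * (complex_of_real (F w u) * h u)"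
      unfolding sym[of u w] by (simp only: mult_ac)
  qed
  also have "\<dots> = q" by (simp only: q_def sum_distrib_left)
  finally have "cnj z = z" using qz \<open>N > 0\<close> by simp
  then obtain r where z: "z = of_real r" by (metis Reals_cases Reals_cnj_iff)
  have re: "(\<Sum>w\<in>V. F u w * Re (h w)) = r * Re (h u)"
    and im: "(\<Sum>w\<in>V. F u w * Im (h w)) = r * Im (h u)" if "u \<in> V" for u
    using arg_cong[OF eig[OF that], of Re] arg_cong[OF eig[OF that], of Im]
    by (simp_all add: z)
  from h obtain v where "v \<in> V" "Re (h v) \<noteq> 0 \<or> Im (h v) \<noteq> 0" by (auto simp: complex_eq_iff)
  then show thesis
    using that[of "\<lambda>w. Re (h w)" r] that[of "\<lambda>w. Im (h w)" r] re im by blast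
qed

text \<open>The parameter \<open>e\<close> allows one treatment of both matrices: \<open>e = 0\<close> is the adjacency matrix and
\<open>e = 1\<close> the signless Laplacian.\<close>

definition degree_adjacency_mat :: "real \<Rightarrow> 'a :: linorder graph \<Rightarrow> real mat" where
  "degree_adjacency_mat e G = e \<cdot>\<^sub>m degree_mat G + adjacency_mat G"

lemma degree_adjacency_mat_carrier:
  "degree_adjacency_mat e G \<in> carrier_mat (card (verts G)) (card (verts G))"
  by (simp add: degree_adjacency_mat_def degree_mat_def adjacency_mat_def)

lemma graph_rho_degree_adjacency_mat: "graph_rho G = Max (spectrum (degree_adjacency_mat 0 G))"
proof -
  have "degree_adjacency_mat 0 G = adjacency_mat G"
    by (rule eq_matI) (auto simp: degree_adjacency_mat_def degree_mat_def adjacency_mat_def)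
  then show ?thesis by (simp add: graph_rho_def)
qed

lemma graph_q_degree_adjacency_mat: "graph_q G = Max (spectrum (degree_adjacency_mat 1 G))"
proof -
  have "degree_adjacency_mat 1 G = degree_mat G + adjacency_mat G"
    by (rule eq_matI) (auto simp: degree_adjacency_mat_def degree_mat_def adjacency_mat_def)
  then show ?thesis by (simp add: graph_q_def)
qed

definition degree_adjacency_entry :: "real \<Rightarrow> 'a graph \<Rightarrow> 'a \<Rightarrow> 'a \<Rightarrow> real" where
  "degree_adjacency_entry e G u w =
     (if u = w then e * vdegree G u else 0) + (if {u, w} \<in> edges G then 1 else 0)"

lemma degree_adjacency_entry_sum:
  assumes "finite (verts G)" "u \<in> verts G"
  shows "(\<Sum>w\<in>verts G. degree_adjacency_entry e G u w * f w) = e * vdegree G u * f u + sum f (nbrs G u)"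
proof -
  have "(\<Sum>w\<in>verts G. degree_adjacency_entry e G u w * f w) =
      (\<Sum>w\<in>verts G. if u = w then e * vdegree G u * f w else 0)
      + (\<Sum>w\<in>verts G. if {u, w} \<in> edges G then f w else 0)"
    unfolding sum.distrib[symmetric]
    by (intro sum.cong) (auto simp: degree_adjacency_entry_def algebra_simps)
  then show ?thesis
    using assms by (simp add: nbrs_def sum.inter_filter)
qed

lemma degree_adjacency_mat_entries:
  assumes "finite (verts G)"
  shows "degree_adjacency_mat e G = mat (card (verts G)) (card (verts G))
    (\<lambda>(i, j). degree_adjacency_entry e G (sorted_list_of_set (verts G) ! i) (sorted_list_of_set (verts G) ! j))"
  using assms
  by (intro eq_matI) (auto simp: degree_adjacency_mat_def degree_mat_def adjacency_mat_def
      degree_adjacency_entry_def vert_list_def nth_eq_iff_index_eq)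

lemma spectrum_degree_adjacency_iff:
  assumes fin: "finite (verts G)"
  shows "\<mu> \<in> spectrum (degree_adjacency_mat e G) \<longleftrightarrow>
    (\<exists>f. (\<exists>v\<in>verts G. f v \<noteq> 0) \<and>
         (\<forall>u\<in>verts G. e * vdegree G u * f u + sum f (nbrs G u) = \<mu> * f u))"
  unfolding spectrum_def mem_Collect_eq
    eigenvalue_iff_vertex_function[OF fin degree_adjacency_mat_entries[OF fin]]
  by (simp add: degree_adjacency_entry_sum[OF fin])

lemma Max_spectrum_degree_adjacency_in:
  assumes fin: "finite (verts G)" and ne: "verts G \<noteq> {}"
  shows "finite (spectrum (degree_adjacency_mat e G))"
    and "Max (spectrum (degree_adjacency_mat e G)) \<in> spectrum (degree_adjacency_mat e G)"
proof -
  show 1: "finite (spectrum (degree_adjacency_mat e G))"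
    by (rule card_finite_spectrum(1)[OF degree_adjacency_mat_carrier])
  have symm: "degree_adjacency_entry e G u w = degree_adjacency_entry e G w u" for u w
    by (auto simp: degree_adjacency_entry_def insert_commute)
  obtain \<mu> f where "\<exists>v\<in>verts G. f v \<noteq> 0"
    "\<And>u. u \<in> verts G \<Longrightarrow> (\<Sum>w\<in>verts G. degree_adjacency_entry e G u w * f w) = \<mu> * f u"
    by (rule symmetric_real_eigenvalue_exists[of "verts G" "degree_adjacency_entry e G", OF fin ne symm]) blast
  then have "\<mu> \<in> spectrum (degree_adjacency_mat e G)"
    unfolding spectrum_degree_adjacency_iff[OF fin]
    by (intro exI[of _ f]) (simp add: degree_adjacency_entry_sum[OF fin])
  then show "Max (spectrum (degree_adjacency_mat e G)) \<in> spectrum (degree_adjacency_mat e G)"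
    using 1 by (intro Max_in) auto
qed

section \<open>Isomorphism and the graph \<open>B_graph n s\<close>\<close>

lemma graph_iso_sym:
  assumes "graph_iso G H"
  shows "graph_iso H G"
proof -
  obtain f where f: "bij_betw f (verts G) (verts H)"
    "\<And>u v. u \<in> verts G \<Longrightarrow> v \<in> verts G \<Longrightarrow> {u, v} \<in> edges G \<longleftrightarrow> {f u, f v} \<in> edges H"
    using assms by (auto simp: graph_iso_def)
  let ?g = "inv_into (verts G) f"
  have g: "bij_betw ?g (verts H) (verts G)" using f(1) by (rule bij_betw_inv_into)
  have "{u, v} \<in> edges H \<longleftrightarrow> {?g u, ?g v} \<in> edges G" if "u \<in> verts H" "v \<in> verts H" for u v
    using f(2)[of "?g u" "?g v"] that bij_betw_apply[OF g] bij_betw_inv_into_right[OF f(1)] by simp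
  with g show ?thesis unfolding graph_iso_def by blast
qed

lemma graph_iso_trans:
  assumes "graph_iso G H" "graph_iso H K"
  shows "graph_iso G K"
proof -
  obtain f where f: "bij_betw f (verts G) (verts H)"
    "\<And>u v. u \<in> verts G \<Longrightarrow> v \<in> verts G \<Longrightarrow> {u, v} \<in> edges G \<longleftrightarrow> {f u, f v} \<in> edges H"
    using assms(1) by (auto simp: graph_iso_def)
  obtain g where g: "bij_betw g (verts H) (verts K)"
    "\<And>u v. u \<in> verts H \<Longrightarrow> v \<in> verts H \<Longrightarrow> {u, v} \<in> edges H \<longleftrightarrow> {g u, g v} \<in> edges K"
    using assms(2) by (auto simp: graph_iso_def)
  have "bij_betw (g \<circ> f) (verts G) (verts K)" using f(1) g(1) by (rule bij_betw_trans)
  moreover have "\<forall>u\<in>verts G. \<forall>v\<in>verts G. {u, v} \<in> edges G \<longleftrightarrow> {(g \<circ> f) u, (g \<circ> f) v} \<in> edges K"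
    using f(2) g(2) bij_betw_apply[OF f(1)] by simp
  ultimately show ?thesis unfolding graph_iso_def by blast
qed

lemma iso_class_eq:
  fixes G H :: "'a graph"
  assumes "graph_iso G H"
  shows "iso_class G = iso_class H"
proof -
  have "graph_iso G K \<longleftrightarrow> graph_iso H K" for K :: "'a graph"
    using graph_iso_trans[OF assms, of K] graph_iso_trans[OF graph_iso_sym[OF assms], of K] by blast
  then show ?thesis by (simp add: iso_class_def)
qed

definition B_adjacent :: "nat \<Rightarrow> nat \<Rightarrow> nat \<Rightarrow> nat \<Rightarrow> bool" where
  "B_adjacent n s x y \<longleftrightarrow> x < n \<and> n \<le> y \<and> y < 2 * n \<and> (s \<le> x \<or> y < n + s)"

lemma verts_B_graph: "verts (B_graph n s) = {0..<2 * n}"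
  by (simp add: B_graph_def)

lemma edges_B_graph_iff:
  assumes "s \<le> n"
  shows "e \<in> edges (B_graph n s) \<longleftrightarrow> (\<exists>x y. e = {x, y} \<and> B_adjacent n s x y)"
proof
  assume "e \<in> edges (B_graph n s)"
  then show "\<exists>x y. e = {x, y} \<and> B_adjacent n s x y"
    using assms by (fastforce simp: B_graph_def B_adjacent_def)
next
  assume "\<exists>x y. e = {x, y} \<and> B_adjacent n s x y"
  then obtain x y where e: "e = {x, y}" "B_adjacent n s x y" by blast
  then have "(x \<in> {0..<s} \<and> y \<in> {n..<n + s}) \<or> (x \<in> {s..<n} \<and> y \<in> {n..<2 * n})"
    by (auto simp: B_adjacent_def)
  then show "e \<in> edges (B_graph n s)" unfolding B_graph_def e(1) by auto
qed

lemma doubleton_edge_B_graph_iff: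
  assumes "s \<le> n"
  shows "{u, v} \<in> edges (B_graph n s) \<longleftrightarrow> B_adjacent n s u v \<or> B_adjacent n s v u"
  unfolding edges_B_graph_iff[OF assms] by (auto simp: doubleton_eq_iff)

lemma B_graph_bipartition:
  assumes "s \<le> n"
  shows "bipartition (B_graph n s) {0..<n} {n..<2 * n}"
  unfolding bipartition_def fin_simple_graph_def verts_B_graph
proof (intro conjI ballI)
  fix e assume "e \<in> edges (B_graph n s)"
  then obtain x y where e: "e = {x, y}" "B_adjacent n s x y" using edges_B_graph_iff[OF assms] by blast
  then have "x \<in> {0..<n}" "y \<in> {n..<2 * n}" by (auto simp: B_adjacent_def)
  then show "\<exists>x\<in>{0..<n}. \<exists>y\<in>{n..<2 * n}. e = {x, y}" using e(1) by blast
  show "e \<subseteq> {0..<2 * n}" using e by (auto simp: B_adjacent_def)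
  have "x \<noteq> y" using e by (auto simp: B_adjacent_def)
  then show "card e = 2" using e by simp
qed auto

lemma nbrs_B_graph:
  assumes "s \<le> n" "u < 2 * n"
  shows "nbrs (B_graph n s) u =
    (if u < s then {n..<n + s} else if u < n then {n..<2 * n}
     else if u < n + s then {0..<n} else {s..<n})"
  using assms
  unfolding nbrs_def verts_B_graph doubleton_edge_B_graph_iff[OF assms(1)] B_adjacent_def
  by auto

lemma B_graph_min_degree:
  assumes "0 < s" "2 * s \<le> n"
  shows "s \<le> min_degree (B_graph n s)"
  unfolding min_degree_def
proof (subst Min_ge_iff)
  show "\<forall>a\<in>vdegree (B_graph n s) ` verts (B_graph n s). s \<le> a"
    using assms by (auto simp: vdegree_eq_card_nbrs nbrs_B_graph verts_B_graph)
qed (use assms in \<open>auto simp: verts_B_graph\<close>)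

text \<open>The \<open>s\<close> vertices of \<open>X\<^sub>1\<close> have neighbours only among the \<open>s\<close> vertices of \<open>Y\<^sub>1\<close>.  On a Hamilton cycle,
both the set of successors and the set of predecessors of \<open>X\<^sub>1\<close> are therefore all of \<open>Y\<^sub>1\<close>, so that
\<open>X\<^sub>1 \<union> Y\<^sub>1\<close> is closed under taking successors and would have to contain every vertex.\<close>

lemma B_graph_not_hamiltonian:
  assumes s: "0 < s" "s < n"
  shows "\<not> hamiltonian (B_graph n s)"
proof
  assume "hamiltonian (B_graph n s)"
  then obtain c where c: "distinct c" "set c = {0..<2 * n}"
    and edge: "\<And>i. i < length c \<Longrightarrow> {c ! i, c ! (Suc i mod length c)} \<in> edges (B_graph n s)"
    by (auto simp: hamiltonian_def hamilton_cycle_def verts_B_graph)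
  define L where "L = length c"
  have L: "L = 2 * n" using distinct_card[OF c(1)] c(2) by (simp add: L_def)
  have L0: "0 < L" using L s by simp
  define succ where "succ i = Suc i mod L" for i
  have bij_c: "bij_betw (\<lambda>i. c ! i) {0..<L} {0..<2 * n}"
    using bij_betw_nth[OF c(1), of "{0..<L}" "{0..<2 * n}"] c(2) by (simp add: L_def lessThan_atLeast0)
  have count: "card {i \<in> {0..<L}. c ! i \<in> Z} = card Z" if "Z \<subseteq> {0..<2 * n}" for Z
  proof -
    have "bij_betw (\<lambda>i. c ! i) {i \<in> {0..<L}. c ! i \<in> Z} Z"
    proof (rule bij_betw_subset[OF bij_c])
      show "(\<lambda>i. c ! i) ` {i \<in> {0..<L}. c ! i \<in> Z} = Z"
      proof
        show "Z \<subseteq> (\<lambda>i. c ! i) ` {i \<in> {0..<L}. c ! i \<in> Z}"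
        proof
          fix z assume z: "z \<in> Z"
          then have "z \<in> (\<lambda>i. c ! i) ` {0..<L}" using that bij_betw_imp_surj_on[OF bij_c] by auto
          then show "z \<in> (\<lambda>i. c ! i) ` {i \<in> {0..<L}. c ! i \<in> Z}" using z by blast
        qed
      qed blast
    qed blast
    then show ?thesis by (rule bij_betw_same_card)
  qed
  \<comment> \<open>\<open>I\<close> and \<open>J\<close> are the positions of \<open>X\<^sub>1\<close> and \<open>Y\<^sub>1\<close> on the cycle, \<open>J'\<close> those of the predecessors of \<open>X\<^sub>1\<close>.\<close>
  define I J where "I = {i \<in> {0..<L}. c ! i \<in> {0..<s}}" and "J = {i \<in> {0..<L}. c ! i \<in> {n..<n + s}}"
  have cards: "card I = s" "card J = s" 
    using count[of "{0..<s}"] count[of "{n..<n + s}"] s by (simp_all add: I_def J_def)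
  have inj: "inj_on succ {0..<L}"
    by (rule inj_onI) (auto simp: succ_def mod_Suc split: if_splits)
  have succ_in: "succ i \<in> {0..<L}" for i using L0 by (simp add: succ_def)
  have surj: "succ ` {0..<L} = {0..<L}"
    by (rule endo_inj_surj[OF _ _ inj]) (use succ_in in auto)
  have nb: "c ! (succ i) \<in> nbrs (B_graph n s) (c ! i)" "c ! i \<in> nbrs (B_graph n s) (c ! (succ i))"
    "c ! i < 2 * n" if "i \<in> {0..<L}" for i
    using edge[of i] that bij_betw_apply[OF bij_c that] bij_betw_apply[OF bij_c succ_in[of i]]
    by (auto simp: nbrs_def verts_B_graph L_def succ_def insert_commute)
  have sn: "s \<le> n" using s by simp
  have IJ: "succ i \<in> J" if "i \<in> I" for i
    using nb[of i] that nbrs_B_graph[OF sn, of "c ! i"] succ_in by (auto simp: I_def J_def)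
  define J' where "J' = {i \<in> {0..<L}. succ i \<in> I}"
  have "J' \<subseteq> J"
  proof
    fix i assume i: "i \<in> J'"
    then have "i \<in> {0..<L}" "c ! succ i < s" by (auto simp: J'_def I_def)
    then have "c ! i \<in> {n..<n + s}"
      using nb(2)[of i] nbrs_B_graph[OF sn, of "c ! succ i"] s by auto
    then show "i \<in> J" using i by (auto simp: J'_def J_def)
  qed
  moreover have "card J' = card J"
  proof -
    have "succ ` J' = I"
    proof
      show "I \<subseteq> succ ` J'"
      proof
        fix i assume i: "i \<in> I"
        then have "i \<in> succ ` {0..<L}" unfolding surj by (simp add: I_def)
        then show "i \<in> succ ` J'" using i by (auto simp: J'_def)
      qed
    qed (auto simp: J'_def)
    moreover have "inj_on succ J'" by (rule inj_on_subset[OF inj]) (auto simp: J'_def)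
    ultimately show ?thesis using cards card_image[of succ J'] by simp
  qed
  ultimately have "J' = J" by (intro card_subset_eq) (auto simp: J_def)
  then have JI: "succ i \<in> I" if "i \<in> J" for i using that by (auto simp: J'_def)
  obtain i0 where i0: "i0 \<in> I" using cards(1) s by fastforce
  have orbit: "(i0 + m) mod L \<in> I \<union> J" for m
  proof (induction m)
    case 0
    then show ?case using i0 by (simp add: I_def)
  next
    case (Suc m)
    have "(i0 + Suc m) mod L = succ ((i0 + m) mod L)" by (simp add: succ_def mod_Suc_eq)
    then show ?case using Suc IJ JI by auto
  qed
  have "{0..<L} \<subseteq> I \<union> J"
  proof
    fix j assume j: "j \<in> {0..<L}"
    have "i0 < L" using i0 by (simp add: I_def)
    then have "(i0 + (j + L - i0)) mod L = j" using j by simp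
    then show "j \<in> I \<union> J" using orbit by metis
  qed
  then have "L \<le> card (I \<union> J)" using card_mono[of "I \<union> J" "{0..<L}"] by (simp add: I_def J_def)
  also have "\<dots> \<le> 2 * s" using card_Un_le[of I J] cards by simp
  finally show False using L s by simp
qed

lemma B_graph_nonham_class:
  assumes "1 \<le> k" "2 * k \<le> n"
  shows "B_graph n k \<in> nonham_class n k"
proof -
  have "balanced_bipartite n (B_graph n k)"
    unfolding balanced_bipartite_bipartition
    using B_graph_bipartition[of k n] assms
    by (intro exI[of _ "{0..<n}"] exI[of _ "{n..<2 * n}"]) auto
  then show ?thesis
    using B_graph_not_hamiltonian[of k n] B_graph_min_degree[of k n] assms
    by (simp add: nonham_class_def)
qed

lemma perron_root_in_B_graph_spectrum:
  assumes pw: "block_perron e s r \<theta> a b c d" and pos: "0 < s" "0 < r"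
  shows "\<theta> \<in> spectrum (degree_adjacency_mat e (B_graph (s + r) s))"
proof -
  let ?B = "B_graph (s + r) s" and ?n = "s + r"
  have eqs: "0 < a" "\<theta> * a = s * (e * a + c)" "\<theta> * b = e * real (s + r) * b + s * c + r * d"
    "\<theta> * c = e * real (s + r) * c + s * a + r * b" "\<theta> * d = e * r * d + r * b"
    using pw by (auto simp: block_perron_def)
  define f where "f v = (if v < s then a else if v < ?n then b else if v < ?n + s then c else d)" for v
  have sums: "sum f {?n..<?n + s} = s * c" "sum f {?n + s..<2 * ?n} = r * d"
      "sum f {0..<s} = s * a" "sum f {s..<?n} = r * b"
  proof -
    have "sum f {?n..<?n + s} = (\<Sum>v\<in>{?n..<?n + s}. c)" by (rule sum.cong) (auto simp: f_def)
    then show "sum f {?n..<?n + s} = s * c" by simp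
    have "sum f {?n + s..<2 * ?n} = (\<Sum>v\<in>{?n + s..<2 * ?n}. d)" by (rule sum.cong) (auto simp: f_def)
    then show "sum f {?n + s..<2 * ?n} = r * d" by simp
    have "sum f {0..<s} = (\<Sum>v\<in>{0..<s}. a)" by (rule sum.cong) (auto simp: f_def)
    then show "sum f {0..<s} = s * a" by simp
    have "sum f {s..<?n} = (\<Sum>v\<in>{s..<?n}. b)" by (rule sum.cong) (auto simp: f_def)
    then show "sum f {s..<?n} = r * b" by simp
  qed
  have joined: "sum f {?n..<2 * ?n} = s * c + r * d" "sum f {0..<?n} = s * a + r * b"
    using sum.atLeastLessThan_concat[of ?n "?n + s" "2 * ?n" f] sum.atLeastLessThan_concat[of 0 s ?n f] sums
    by simp_all
  have eig: "e * vdegree ?B u * f u + sum f (nbrs ?B u) = \<theta> * f u" if "u < 2 * ?n" for u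
  proof -
    consider "u < s" | "s \<le> u" "u < ?n" | "?n \<le> u" "u < ?n + s" | "?n + s \<le> u" by linarith
    then show ?thesis
    proof cases
      case 1
      then have "nbrs ?B u = {?n..<?n + s}" "f u = a" using nbrs_B_graph[of s ?n u] by (auto simp: f_def)
      then show ?thesis using eqs sums by (simp add: vdegree_eq_card_nbrs algebra_simps)
    next
      case 2
      then have "nbrs ?B u = {?n..<2 * ?n}" "f u = b" using nbrs_B_graph[of s ?n u] by (auto simp: f_def)
      then show ?thesis using eqs joined by (simp add: vdegree_eq_card_nbrs algebra_simps)
    next
      case 3
      then have "nbrs ?B u = {0..<?n}" "f u = c" using nbrs_B_graph[of s ?n u] pos by (auto simp: f_def)
      then show ?thesis using eqs joined by (simp add: vdegree_eq_card_nbrs algebra_simps)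
    next
      case 4
      then have "nbrs ?B u = {s..<?n}" "f u = d" using nbrs_B_graph[of s ?n u] that by (auto simp: f_def)
      then show ?thesis using eqs sums by (simp add: vdegree_eq_card_nbrs algebra_simps)
    qed
  qed
  have "f 0 \<noteq> 0" using eqs(1) pos by (simp add: f_def)
  then have "\<exists>v\<in>verts ?B. f v \<noteq> 0" using pos by (intro bexI[of _ 0]) (simp_all add: verts_B_graph)
  then show ?thesis
    using eig by (subst spectrum_degree_adjacency_iff) (auto simp: verts_B_graph intro!: exI[of _ f])
qed

text \<open>Together with the bipartition, the neighbourhoods of one side determine all edges, so any bijection
that respects the four blocks is an isomorphism.\<close>

lemma graph_iso_B_graph:
  fixes G :: "'a graph"
  assumes bip: "bipartition G X Y" and cX: "card X = n" and cY: "card Y = n"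
    and S: "S \<subseteq> X" "card S = s" and T: "T \<subseteq> Y" "card T = s"
    and nb: "\<And>x. x \<in> X \<Longrightarrow> nbrs G x = (if x \<in> S then T else Y)"
  shows "graph_iso G (B_graph n s)"
proof -
  have V: "verts G = X \<union> Y" "X \<inter> Y = {}" using bip by (auto simp: bipartition_def)
  have fin: "finite X" "finite Y" using bipartition_finite[OF bip] by auto
  have finST: "finite S" "finite T" using S T fin by (auto intro: finite_subset)
  have sn: "s \<le> n" using S cX fin card_mono by metis
  have "card (X - S) = n - s" "card (Y - T) = n - s"
    using S T cX cY finST by (simp_all add: card_Diff_subset)
  then obtain f1 f2 f3 f4 where
    f1: "bij_betw f1 S {0..<s}" and f2: "bij_betw f2 (X - S) {s..<n}" and
    f3: "bij_betw f3 T {n..<n + s}" and f4: "bij_betw f4 (Y - T) {n + s..<2 * n}"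
    using finite_same_card_bij[of S "{0..<s}"] finite_same_card_bij[of "X - S" "{s..<n}"]
      finite_same_card_bij[of T "{n..<n + s}"] finite_same_card_bij[of "Y - T" "{n + s..<2 * n}"]
      finST fin S T by auto
  define f where "f v = (if v \<in> S then f1 v else if v \<in> X - S then f2 v else if v \<in> T then f3 v else f4 v)" for v
  have "bij_betw f S {0..<s}" using f1 by (rule bij_betw_cong[THEN iffD1, rotated]) (auto simp: f_def)
  moreover have "bij_betw f (X - S) {s..<n}"
    using f2 by (rule bij_betw_cong[THEN iffD1, rotated]) (auto simp: f_def)
  ultimately have bX: "bij_betw f (S \<union> (X - S)) ({0..<s} \<union> {s..<n})"
    by (rule bij_betw_combine) auto
  have "bij_betw f T {n..<n + s}"
    using f3 by (rule bij_betw_cong[THEN iffD1, rotated]) (use V S T in \<open>auto simp: f_def\<close>)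
  moreover have "bij_betw f (Y - T) {n + s..<2 * n}"
    using f4 by (rule bij_betw_cong[THEN iffD1, rotated]) (use V S T in \<open>auto simp: f_def\<close>)
  ultimately have bY: "bij_betw f (T \<union> (Y - T)) ({n..<n + s} \<union> {n + s..<2 * n})"
    by (rule bij_betw_combine) auto
  have "bij_betw f ((S \<union> (X - S)) \<union> (T \<union> (Y - T))) (({0..<s} \<union> {s..<n}) \<union> ({n..<n + s} \<union> {n + s..<2 * n}))"
    using bX bY by (rule bij_betw_combine) (use sn in auto)
  moreover have "(S \<union> (X - S)) \<union> (T \<union> (Y - T)) = verts G" using V S T by auto
  moreover have "({0..<s} \<union> {s..<n}) \<union> ({n..<n + s} \<union> {n + s..<2 * n}) = {0..<2 * n}" using sn by auto
  ultimately have bij: "bij_betw f (verts G) {0..<2 * n}" by simp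
  have fX: "f x < n \<and> (f x < s \<longleftrightarrow> x \<in> S)" if "x \<in> X" for x
    using that bij_betw_apply[OF f1, of x] bij_betw_apply[OF f2, of x] S sn
    by (cases "x \<in> S") (auto simp: f_def)
  have fY: "n \<le> f y \<and> f y < 2 * n \<and> (f y < n + s \<longleftrightarrow> y \<in> T)" if "y \<in> Y" for y
    using that bij_betw_apply[OF f3, of y] bij_betw_apply[OF f4, of y] S T sn V
    by (cases "y \<in> T") (auto simp: f_def)
  have XY: "{x, y} \<in> edges G \<longleftrightarrow> {f x, f y} \<in> edges (B_graph n s)" if "x \<in> X" "y \<in> Y" for x y
  proof -
    have "{x, y} \<in> edges G \<longleftrightarrow> y \<in> nbrs G x" using that V by (auto simp: nbrs_def)
    also have "\<dots> \<longleftrightarrow> x \<notin> S \<or> y \<in> T" using nb[OF that(1)] that T by auto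
    also have "\<dots> \<longleftrightarrow> {f x, f y} \<in> edges (B_graph n s)"
      unfolding doubleton_edge_B_graph_iff[OF sn] B_adjacent_def using fX[OF that(1)] fY[OF that(2)]
      by auto
    finally show ?thesis .
  qed
  have same: "{u, v} \<notin> edges G \<and> {f u, f v} \<notin> edges (B_graph n s)"
    if "u \<in> X \<and> v \<in> X \<or> u \<in> Y \<and> v \<in> Y" for u v
  proof
    show "{u, v} \<notin> edges G"
      using that bipartition_nbrs[OF bip, of u] bipartition_nbrs[OF bipartition_commute[OF bip], of u] V
      by (auto simp: nbrs_def)
    show "{f u, f v} \<notin> edges (B_graph n s)"
      unfolding doubleton_edge_B_graph_iff[OF sn] B_adjacent_def using that fX[of u] fX[of v] fY[of u] fY[of v]
      by auto
  qed
  have "{u, v} \<in> edges G \<longleftrightarrow> {f u, f v} \<in> edges (B_graph n s)"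
    if "u \<in> verts G" "v \<in> verts G" for u v
  proof -
    consider "u \<in> X" "v \<in> Y" | "u \<in> Y" "v \<in> X" | "u \<in> X \<and> v \<in> X \<or> u \<in> Y \<and> v \<in> Y"
      using \<open>u \<in> verts G\<close> \<open>v \<in> verts G\<close> V by blast
    then show ?thesis
    proof cases
      case 1 then show ?thesis by (rule XY)
    next
      case 2 then show ?thesis using XY[of v u] by (simp add: insert_commute)
    next
      case 3 then show ?thesis using same by blast
    qed
  qed
  with bij show ?thesis unfolding graph_iso_def verts_B_graph by blast
qed

section \<open>The extremal graph\<close>

text \<open>Passing to the absolute value of an eigenvector turns the eigenvalue equations into inequalities, by
the triangle inequality; nonnegativity is what the comparison of block sums is built on.\<close>

lemma eigenvalue_abs_inequality:
  assumes fin: "finite (verts G)" and e: "0 \<le> e"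
    and mem: "\<mu> \<in> spectrum (degree_adjacency_mat e G)"
  obtains g v0 where "v0 \<in> verts G" "g v0 \<noteq> 0" "\<And>v. 0 \<le> g v"
    "\<And>v. v \<in> verts G \<Longrightarrow> \<mu> * g v \<le> e * vdegree G v * g v + sum g (nbrs G v)"
proof -
  obtain f v0 where v0: "v0 \<in> verts G" "f v0 \<noteq> 0"
    and eig: "\<And>u. u \<in> verts G \<Longrightarrow> e * vdegree G u * f u + sum f (nbrs G u) = \<mu> * f u"
    using mem spectrum_degree_adjacency_iff[OF fin] by blast
  have "\<mu> * \<bar>f v\<bar> \<le> e * vdegree G v * \<bar>f v\<bar> + (\<Sum>w\<in>nbrs G v. \<bar>f w\<bar>)" if v: "v \<in> verts G" for v
  proof -
    have "\<mu> * \<bar>f v\<bar> \<le> \<bar>\<mu>\<bar> * \<bar>f v\<bar>" by (intro mult_right_mono) auto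
    also have "\<dots> = \<bar>e * vdegree G v * f v + sum f (nbrs G v)\<bar>"
      by (simp only: eig[OF v] abs_mult)
    also have "\<dots> \<le> \<bar>e * vdegree G v * f v\<bar> + \<bar>sum f (nbrs G v)\<bar>" by (rule abs_triangle_ineq)
    also have "\<dots> \<le> e * vdegree G v * \<bar>f v\<bar> + (\<Sum>w\<in>nbrs G v. \<bar>f w\<bar>)"
      using e by (intro add_mono sum_abs) (simp add: abs_mult)
    finally show ?thesis .
  qed
  then show thesis using that[of v0 "\<lambda>v. \<bar>f v\<bar>"] v0 by simp
qed

text \<open>The function \<open>\<Theta>\<close> stands for the closed form of the largest eigenvalue of \<open>B_graph n s\<close> in terms of
\<open>n\<close> and \<open>p = s * (n - s)\<close>.  Since \<open>s * (n - s) - k * (n - k) = (s - k) * (n - s - k)\<close> is positive for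
\<open>k < s \<le> n / 2\<close>, every \<open>s > k\<close> gives a strictly smaller bound than \<open>s = k\<close>.\<close>

lemma nonham_class_eigenvalue_bound:
  fixes \<Theta> :: "real \<Rightarrow> real \<Rightarrow> real"
  assumes k: "1 \<le> k" "2 * k \<le> n" and e: "0 \<le> e"
    and perron: "\<And>s r. 0 < s \<Longrightarrow> 0 < r \<Longrightarrow>
        \<exists>a b c d. block_perron e s r (\<Theta> (real (s + r)) (real (s * r))) a b c d"
    and anti: "\<And>p p'. 0 \<le> p \<Longrightarrow> p < p' \<Longrightarrow> 4 * p' \<le> (real n)\<^sup>2 \<Longrightarrow> \<Theta> (real n) p' < \<Theta> (real n) p"
    and G: "G \<in> nonham_class n k" and mem: "\<mu> \<in> spectrum (degree_adjacency_mat e G)"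
  shows "\<mu> \<le> \<Theta> n (real (k * (n - k)))"
    and "\<mu> = \<Theta> n (real (k * (n - k))) \<Longrightarrow> graph_iso G (B_graph n k)"
proof -
  have n2: "2 \<le> n" using k by simp
  have bal: "balanced_bipartite n G" and no: "\<not> hamiltonian G"
    using G by (simp_all add: nonham_class_def)
  obtain X Y S s where bip: "bipartition G X Y" and cX: "card X = n" and cY: "card Y = n"
    and S: "S \<subseteq> X" "card S = s" and s2: "2 * s \<le> n" and deg: "\<And>x. x \<in> S \<Longrightarrow> vdegree G x \<le> s"
    and low: "\<exists>v\<in>verts G. vdegree G v \<le> s"
    by (rule nonhamiltonian_low_degree_set[OF bal no n2]) blast
  have fin: "finite (verts G)" using bip bipartition_finite[OF bip] by (auto simp only: bipartition_def finite_Un)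
  have "k \<le> s"
  proof -
    obtain v where v: "v \<in> verts G" "vdegree G v \<le> s" using low by blast
    have "k \<le> min_degree G" using G by (simp add: nonham_class_def)
    also have "\<dots> \<le> vdegree G v" unfolding min_degree_def using fin v by (intro Min_le) auto
    finally show ?thesis using v by simp
  qed
  define r where "r = n - s"
  have r: "0 < s" "0 < r" "s + r = n" using \<open>k \<le> s\<close> k s2 by (auto simp: r_def)
  let ?t = "\<lambda>j. \<Theta> n (real (j * (n - j)))"
  have root_less: "?t s < ?t k" if "k < s"
  proof (rule anti)
    have "real k * (real n - real k) < real s * (real n - real s)"
    proof -
      have "0 < (real s - real k) * (real n - real s - real k)" using that s2 by (intro mult_pos_pos) linarith+
      then show ?thesis by (simp add: algebra_simps)
    qed
    then show "real (k * (n - k)) < real (s * (n - s))" using k s2 by (simp add: of_nat_diff)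
    have "0 \<le> (real n - 2 * real s)\<^sup>2" by simp
    then show "4 * real (s * (n - s)) \<le> (real n)\<^sup>2"
      using s2 by (simp add: of_nat_diff power2_eq_square algebra_simps)
  qed simp
  obtain a b c d where pw: "block_perron e s r (?t s) a b c d"
    using perron[OF r(1,2)] r by (auto simp: r_def)
  obtain g v0 where g: "v0 \<in> verts G" "g v0 \<noteq> 0" "\<And>v. 0 \<le> g v"
    "\<And>v. v \<in> verts G \<Longrightarrow> \<mu> * g v \<le> e * vdegree G v * g v + sum g (nbrs G v)"
    by (rule eigenvalue_abs_inequality[OF fin e mem]) (rule that)
  have cXr: "card X = s + r" and cYr: "card Y = s + r" using cX cY r by simp_all
  have le_s: "\<mu> \<le> ?t s"
    by (rule eigenvalue_bound_of_low_degree_set(1)[where g = g, OF bip cXr cYr S _ r(1,2) e pw _ g(1,2)])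
      (erule deg, rule g(3), erule g(4))
  have s_cases: "s = k \<or> k < s" using \<open>k \<le> s\<close> by linarith
  then show "\<mu> \<le> ?t k" using le_s root_less by force
  assume eq: "\<mu> = ?t k"
  then have sk: "s = k" using s_cases le_s root_less by force
  have "\<mu> = ?t s" using eq sk by simp
  have "\<exists>T\<subseteq>Y. card T = s \<and> (\<forall>x\<in>X. nbrs G x = (if x \<in> S then T else Y))"
    by (rule eigenvalue_bound_of_low_degree_set(2)[where g = g, OF bip cXr cYr S _ r(1,2) e pw _ g(1,2) _ \<open>\<mu> = ?t s\<close>])
      (erule deg, rule g(3), erule g(4))
  then obtain T where T: "T \<subseteq> Y" "card T = s" "\<forall>x\<in>X. nbrs G x = (if x \<in> S then T else Y)"
    by blast
  have "graph_iso G (B_graph n s)"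
    by (rule graph_iso_B_graph[OF bip cX cY S T(1,2)]) (use T(3) in blast)
  then show "graph_iso G (B_graph n k)" by (simp add: sk)
qed

text \<open>The closed form is attained by \<open>B_graph n k\<close>, because it belongs to the spectrum and, by the bound for
the whole class, no eigenvalue exceeds it.\<close>

lemma B_graph_unique_maximum:
  fixes \<Theta> :: "real \<Rightarrow> real \<Rightarrow> real" and lam :: "nat graph \<Rightarrow> real"
  assumes k: "1 \<le> k" "2 * k \<le> n" and e: "0 \<le> e"
    and perron: "\<And>s r. 0 < s \<Longrightarrow> 0 < r \<Longrightarrow>
        \<exists>a b c d. block_perron e s r (\<Theta> (real (s + r)) (real (s * r))) a b c d"
    and anti: "\<And>p p'. 0 \<le> p \<Longrightarrow> p < p' \<Longrightarrow> 4 * p' \<le> (real n)\<^sup>2 \<Longrightarrow> \<Theta> (real n) p' < \<Theta> (real n) p"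
    and lam: "\<And>G. lam G = Max (spectrum (degree_adjacency_mat e G))"
  shows "SPEX lam n k = {iso_class (B_graph n k)} \<and> spex lam n k = lam (B_graph n k)"
proof -
  let ?B = "B_graph n k" and ?t = "\<Theta> n (real (k * (n - k)))"
  note bound = nonham_class_eigenvalue_bound[where \<Theta> = \<Theta>, OF k e]
  have B: "?B \<in> nonham_class n k" using B_graph_nonham_class[OF k] .
  have spec: "finite (spectrum (degree_adjacency_mat e G))" "lam G \<in> spectrum (degree_adjacency_mat e G)"
    if G: "G \<in> nonham_class n k" for G
  proof -
    obtain X Y where "bipartition G X Y" "card X = n"
      using G by (auto simp: nonham_class_def balanced_bipartite_bipartition)
    then have "finite (verts G)" "verts G \<noteq> {}"
      using k by (auto simp: bipartition_def fin_simple_graph_def)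
    then show "finite (spectrum (degree_adjacency_mat e G))" "lam G \<in> spectrum (degree_adjacency_mat e G)"
      unfolding lam by (rule Max_spectrum_degree_adjacency_in)+
  qed
  have upper: "lam G \<le> ?t" if "G \<in> nonham_class n k" for G
    by (rule bound(1)[OF _ _ that spec(2)[OF that]]) (fact perron, fact anti)
  have unique: "graph_iso G ?B" if "G \<in> nonham_class n k" "lam G = ?t" for G
    by (rule bound(2)[OF _ _ that(1) spec(2)[OF that(1)] that(2)]) (fact perron, fact anti)
  have "lam ?B = ?t"
  proof (rule antisym[OF upper[OF B]])
    have "k + (n - k) = n" "0 < k" "0 < n - k" using k by auto
    then obtain a b c d where "block_perron e k (n - k) ?t a b c d"
      using perron[of k "n - k"] by auto
    then have "?t \<in> spectrum (degree_adjacency_mat e ?B)"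
      using perron_root_in_B_graph_spectrum \<open>k + (n - k) = n\<close> \<open>0 < k\<close> \<open>0 < n - k\<close> by metis
    then show "?t \<le> lam ?B" unfolding lam using spec(1)[OF B] by (intro Max_ge)
  qed
  then have max: "lam H \<le> lam ?B" if "H \<in> nonham_class n k" for H using upper[OF that] by simp
  have "iso_class G = iso_class ?B"
    if "G \<in> nonham_class n k" "\<forall>H\<in>nonham_class n k. lam H \<le> lam G" for G
  proof -
    have "lam G = ?t" using that B upper[OF that(1)] \<open>lam ?B = ?t\<close> by force
    then show ?thesis using unique[OF that(1)] iso_class_eq by blast
  qed
  then have "SPEX lam n k = {iso_class ?B}" unfolding SPEX_def using B max by blast
  moreover have "spex lam n k = lam ?B"
    unfolding spex_def by (rule Greatest_equality) (use B max in auto)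
  ultimately show ?thesis ..
qed

theorem theorem1p7:
  fixes k n :: nat
  assumes "k \<ge> 1" and "n \<ge> 2 * k"
  shows "SPEX graph_rho n k = {iso_class (B_graph n k)} \<and>
         spex graph_rho n k = graph_rho (B_graph n k) \<and>
         SPEX graph_q n k = {iso_class (B_graph n k)} \<and>
         spex graph_q n k = graph_q (B_graph n k)"
proof -
  have "SPEX graph_rho n k = {iso_class (B_graph n k)} \<and> spex graph_rho n k = graph_rho (B_graph n k)"
    using assms by (intro B_graph_unique_maximum[where e = 0 and \<Theta> = adjacency_root]
        adjacency_perron_exists adjacency_root_strict_antimono graph_rho_degree_adjacency_mat) simp_all
  moreover have "SPEX graph_q n k = {iso_class (B_graph n k)} \<and> spex graph_q n k = graph_q (B_graph n k)"
    using assms by (intro B_graph_unique_maximum[where e = 1 and \<Theta> = signless_root]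
        signless_perron_exists signless_root_strict_antimono graph_q_degree_adjacency_mat) simp_all
  ultimately show ?thesis by blast
qed

end
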